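(* If $K$ is an infinite finite-dimensional Valdivia compact space, then $C_p(K)$ and $C_w(K)$ are not homeomorphic.
   Context: All topological spaces are assumed to be Tychonoff, so compact spaces are compact Hausdorff. For a compact space $K$, $C(K)$ denotes the Banach space of all real-valued continuous functions on $K$ with the supremum norm. $C_w(K)$ denotes the set $C(K)$ equipped with the weak topology of this Banach space (the weakest topology making all norm-continuous linear functionals on $C(K)$ continuous). $C_p(K)$ denotes the set $C(K)$ equipped with the pointwise topology, i.e. the topology inherited from the product space $\mathbb{R}^K$. Finite-dimensional means of finite covering dimension. For a set $\Gamma$, $\Sigma(\Gamma)$ denotes the subspace of $\mathbb{R}^\Gamma$ consisting of functions with countable support. A compact space $K$ is a Valdivia compact space if, for some set $\Gamma$, there exists an embedding $i:K\to\mathbb{R}^\Gamma$ such that $i(K)\cap\Sigma(\Gamma)$ is dense in $i(K)$. *)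

theory Defs
  imports "HOL-Analysis.Analysis"
begin

text \<open>
  For a compact Hausdorff space \<open>K\<close>, given as a type \<open>'a\<close> with compact universe, every continuous
  real function is bounded, so the library's Banach space \<open>'a \<Rightarrow>\<^sub>C real\<close> with the supremum norm
  is \<open>C(K)\<close>.
\<close>

definition weak_topology :: "'b::real_normed_vector topology" where
  "weak_topology =
     topology_generated_by {\<phi> -` U | (\<phi> :: 'b \<Rightarrow> real) U. bounded_linear \<phi> \<and> open U}"

definition pointwise_topology :: "('a::topological_space \<Rightarrow>\<^sub>C real) topology" where
  "pointwise_topology =
     pullback_topology UNIV apply_bcontfun (product_topology (\<lambda>x. euclideanreal) UNIV)"

text \<open>
  Covering dimension at most \<open>n\<close>. The definition uses finite open covers, which is the
  standard one for normal, in particular for compact Hausdorff, spaces (for general Tychonoff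
  spaces one has to use functionally open covers instead).
\<close>

definition covering_dim_le :: "'a topology \<Rightarrow> nat \<Rightarrow> bool" where
  "covering_dim_le X n \<longleftrightarrow>
     (\<forall>\<U>. finite \<U> \<and> (\<forall>U\<in>\<U>. openin X U) \<and> \<Union>\<U> = topspace X \<longrightarrow>
       (\<exists>\<V>. finite \<V> \<and> (\<forall>V\<in>\<V>. openin X V) \<and> \<Union>\<V> = topspace X \<and>
            (\<forall>V\<in>\<V>. \<exists>U\<in>\<U>. V \<subseteq> U) \<and>
            (\<forall>x\<in>topspace X. card {V\<in>\<V>. x \<in> V} \<le> n + 1)))"

definition finite_dimensional :: "'a topology \<Rightarrow> bool" where
  "finite_dimensional X \<longleftrightarrow> (\<exists>n. covering_dim_le X n)"

text \<open>
  In \<open>product_topology\<close> the points of \<open>\<real>\<^sup>\<Gamma>\<close> are represented by extensional functions on \<open>\<Gamma>\<close>.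
\<close>

abbreviation real_power :: "'g set \<Rightarrow> ('g \<Rightarrow> real) topology" where
  "real_power \<Gamma> \<equiv> product_topology (\<lambda>\<gamma>. euclideanreal) \<Gamma>"

definition sigma_product :: "'g set \<Rightarrow> ('g \<Rightarrow> real) set" where
  "sigma_product \<Gamma> = {f \<in> topspace (real_power \<Gamma>). countable {\<gamma>\<in>\<Gamma>. f \<gamma> \<noteq> 0}}"

text \<open>
  Since HOL cannot quantify over types inside a formula, the type \<open>'g\<close> that contains the index
  set \<open>\<Gamma>\<close> is an explicit parameter. A theorem that assumes \<open>valdivia_compact TYPE('g) X\<close> for a
  type variable \<open>'g\<close> covers all index sets.
\<close>

definition valdivia_compact :: "'g itself \<Rightarrow> 'a topology \<Rightarrow> bool" where
  "valdivia_compact _ X \<longleftrightarrow>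
     compact_space X \<and> Hausdorff_space X \<and>
     (\<exists>(\<Gamma> :: 'g set) i.
        embedding_map X (real_power \<Gamma>) i \<and>
        subtopology (real_power \<Gamma>) (i ` topspace X) closure_of
          (i ` topspace X \<inter> sigma_product \<Gamma>) = i ` topspace X)"

end

theory Submission
  imports Defs
begin

text \<open>
  Let \<open>\<Phi>\<close> be a homeomorphism of \<open>C\<^sub>p(K)\<close> onto \<open>C\<^sub>w(K)\<close>. Closing a countable set of functions
  under \<open>\<Phi>\<close>, its inverse, the rational lattice operations and refinements of cozero covers yields
  a map \<open>q\<close> of \<open>K\<close> onto a finite-dimensional metrizable compact space \<open>M\<close>. For \<open>t\<close> in the Hilbert
  cube let \<open>\<mu>\<^sub>t\<close> be the measure \<open>\<Sum>j. t\<^sub>j 2\<^sup>-\<^sup>j \<delta>(x\<^sub>j)\<close>, where the points \<open>q(x\<^sub>j)\<close> are distinct. Continuity of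
  \<open>\<Phi>\<close> relates to every \<open>t\<close> some \<open>n\<close> and a finite tuple \<open>z\<close> of points of \<open>M\<close> such that \<open>\<bar>f\<bar> < 1/n\<close> on
  \<open>z\<close> implies \<open>\<bar>\<mu>\<^sub>t(\<Phi> f - \<Phi> 0)\<bar> \<le> 1\<close>. Continuity of the inverse confines all \<open>t\<close> that are related to
  one \<open>z\<close> to a finite-dimensional space, whereas a tuple enumerating a minimal set is isolated
  among the tuples related to \<open>t\<close>. Because the powers of \<open>M\<close> are finite-dimensional, the
  Hilbert cube is then covered by disjoint pairs of open sets \<open>A\<^sub>i\<close>, \<open>B\<^sub>i\<close> such that \<open>A\<^sub>i\<close> misses the
  face \<open>t\<^sub>i = 1\<close> and \<open>B\<^sub>i\<close> the face \<open>t\<^sub>i = 0\<close>, which Kuhn's lemma forbids.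
\<close>

section \<open>Open covers of the Hilbert cube\<close>

text \<open>A basic neighbourhood in the pointwise topology restricts a function at finitely many
  points, whereas a norm-continuous functional may charge infinitely many. Since a homeomorphism
  need not be linear, the points that control a functional through \<open>\<Phi>\<close> come
  without a bound on their number and without continuous dependence on the functional. Therefore the
  proof works with closed relations, one for every tolerance n and tuple length m, instead of a map,
  and with a family of functionals so large that countably many thin pieces cannot exhaust it.
  Metrizability of M supplies a countable base, which turns isolated tuples into unique ones at the
  price of countably many more pieces. Every piece, and within a piece every color of a refinement,
  receives its own infinite supply of coordinates of the cube, so that the pairs of open sets built
  for different pieces need not be compatible. The supplies are infinite because the number of
  coordinates used near a tuple depends on the tuple, and no bound for it is available.\<close>

lemma tendsto_funI:
  fixes f :: "'c \<Rightarrow> 'i \<Rightarrow> 'b::topological_space"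
  assumes "\<And>i. ((\<lambda>c. f c i) \<longlongrightarrow> l i) F"
  shows "(f \<longlongrightarrow> l) F"
proof -
  have "limitin (product_topology (\<lambda>i. euclidean) UNIV) f l F"
    using assms by (simp add: limitin_componentwise)
  then show ?thesis
    by (simp add: euclidean_product_topology)
qed

lemma compact_Pi_UNIV:
  fixes S :: "'i \<Rightarrow> 'b::topological_space set"
  assumes "\<And>i. compact (S i)"
  shows "compact (Pi UNIV S)"
proof -
  have "compactin (product_topology (\<lambda>i. euclidean) UNIV) (Pi\<^sub>E UNIV S)"
    using assms by (simp add: compactin_PiE)
  then show ?thesis
    by (simp add: euclidean_product_topology PiE_UNIV_domain)
qed

definition hilbert_cube :: "(nat \<Rightarrow> real) set" where
  "hilbert_cube = UNIV \<rightarrow> {0..1}"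

lemma compact_hilbert_cube: "compact hilbert_cube"
  unfolding hilbert_cube_def by (rule compact_Pi_UNIV) simp

text \<open>Coordinate i of a grid point is labelled by the side, \<open>A i\<close> or
  \<open>B i\<close>, to which the point belongs. Kuhn's lemma finds in every grid a cell on which
  each of finitely many labels takes both values. The cells accumulate at a point of some open
  \<open>A i\<close> or \<open>B i\<close>, near which label i is constant.\<close>

lemma hilbert_cube_no_disjoint_cover:
  assumes op: "\<And>i. open (A i)" "\<And>i. open (B i)"
    and disj: "\<And>i. A i \<inter> B i = {}"
    and A1: "\<And>i t. t \<in> A i \<Longrightarrow> t i \<noteq> 1" and B0: "\<And>i t. t \<in> B i \<Longrightarrow> t i \<noteq> 0"
    and cover: "hilbert_cube \<subseteq> (\<Union>i. A i \<union> B i)"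
  shows False
proof -
  obtain C where C: "finite C" "hilbert_cube \<subseteq> (\<Union>i\<in>C. A i \<union> B i)"
    using compactE_image[OF compact_hilbert_cube, of UNIV "\<lambda>i. A i \<union> B i"] op cover by (metis open_Un)
  obtain n where n: "C \<subseteq> {..<n}"
    using finite_nat_bounded[OF C(1)] by blast
  \<comment> \<open>The grid has mesh \<open>1 / Suc k\<close>. Compactness left only indices below
    n, so the other coordinates are frozen at 0.\<close>
  define pt where "pt k x = (\<lambda>i. if i < n then real (x i) / real (Suc k) else 0)" for k and x :: "nat \<Rightarrow> nat"
  \<comment> \<open>Off \<open>A i\<close> and \<open>B i\<close> the label is only arranged to meet
    the boundary conditions of Kuhn's lemma: 1 on the far face, 0 elsewhere. On \<open>A i\<close>
    and \<open>B i\<close> these conditions hold by \<open>A1\<close> and \<open>B0\<close>.\<close>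
  define label where "label k x i = (if pt k x \<in> A i then 0 else if pt k x \<in> B i then 1
    else if x i = Suc k then 1 else (0::nat))" for k x i
  have ex: "\<exists>q r s. (\<forall>i<n. q i < Suc k) \<and>
      (\<forall>i<n. (\<forall>j<n. q j \<le> r i j \<and> r i j \<le> q j + 1) \<and> (\<forall>j<n. q j \<le> s i j \<and> s i j \<le> q j + 1) \<and>
         label k (r i) i \<noteq> label k (s i) i)" for k
  proof -
    obtain q where q: "\<forall>i<n. q i < Suc k"
      "\<forall>i<n. \<exists>r s. (\<forall>j<n. q j \<le> r j \<and> r j \<le> q j + 1) \<and> (\<forall>j<n. q j \<le> s j \<and> s j \<le> q j + 1) \<and>
         label k r i \<noteq> label k s i"
    proof (rule kuhn_lemma[of "Suc k" n "label k"])
      show "\<forall>x. (\<forall>i<n. x i \<le> Suc k) \<longrightarrow> (\<forall>i<n. label k x i = 0 \<or> label k x i = 1)"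
        by (auto simp: label_def)
      show "\<forall>x. (\<forall>i<n. x i \<le> Suc k) \<longrightarrow> (\<forall>i<n. x i = 0 \<longrightarrow> label k x i = 0)"
      proof (intro allI impI)
        fix x :: "nat \<Rightarrow> nat" and i assume "i < n" "x i = 0"
        then have "pt k x i = 0" by (simp add: pt_def)
        then have "pt k x \<notin> B i" using B0 by blast
        then show "label k x i = 0" using \<open>x i = 0\<close> by (simp add: label_def)
      qed
      show "\<forall>x. (\<forall>i<n. x i \<le> Suc k) \<longrightarrow> (\<forall>i<n. x i = Suc k \<longrightarrow> label k x i = 1)"
      proof (intro allI impI)
        fix x :: "nat \<Rightarrow> nat" and i assume "i < n" "x i = Suc k"
        then have "pt k x i = 1" by (simp add: pt_def)
        then have "pt k x \<notin> A i" using A1 by blast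
        then show "label k x i = 1" using \<open>x i = Suc k\<close> by (simp add: label_def)
      qed
    qed auto
    then have "\<forall>i. \<exists>r s. i < n \<longrightarrow> (\<forall>j<n. q j \<le> r j \<and> r j \<le> q j + 1) \<and>
        (\<forall>j<n. q j \<le> s j \<and> s j \<le> q j + 1) \<and> label k r i \<noteq> label k s i"
      by blast
    then obtain r where "\<forall>i. \<exists>s. i < n \<longrightarrow> (\<forall>j<n. q j \<le> r i j \<and> r i j \<le> q j + 1) \<and>
        (\<forall>j<n. q j \<le> s j \<and> s j \<le> q j + 1) \<and> label k (r i) i \<noteq> label k s i"
      by (rule choice[THEN exE])
    then obtain s where "\<forall>i. i < n \<longrightarrow> (\<forall>j<n. q j \<le> r i j \<and> r i j \<le> q j + 1) \<and>
        (\<forall>j<n. q j \<le> s i j \<and> s i j \<le> q j + 1) \<and> label k (r i) i \<noteq> label k (s i) i"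
      by (rule choice[THEN exE])
    with q(1) have "(\<forall>i<n. q i < Suc k) \<and>
      (\<forall>i<n. (\<forall>j<n. q j \<le> r i j \<and> r i j \<le> q j + 1) \<and> (\<forall>j<n. q j \<le> s i j \<and> s i j \<le> q j + 1) \<and>
         label k (r i) i \<noteq> label k (s i) i)"
      by (intro conjI)
    then show ?thesis by (intro exI)
  qed
  define Q where "Q k q r s \<longleftrightarrow> (\<forall>i<n. q i < Suc k) \<and>
      (\<forall>i<n. (\<forall>j<n. q j \<le> r i j \<and> r i j \<le> q j + 1) \<and> (\<forall>j<n. q j \<le> s i j \<and> s i j \<le> q j + 1) \<and>
         label k (r i) i \<noteq> label k (s i) i)" for k q r s
  obtain q where "\<forall>k. \<exists>r s. Q k (q k) r s"
    using choice[OF allI[OF ex[folded Q_def]]] by (rule exE)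
  then obtain r where "\<forall>k. \<exists>s. Q k (q k) (r k) s"
    by (rule choice[THEN exE])
  then obtain s where Q: "\<forall>k. Q k (q k) (r k) (s k)"
    by (rule choice[THEN exE])
  have q: "q k i < Suc k" if "i < n" for k i using Q that unfolding Q_def by blast
  have r: "q k j \<le> r k i j \<and> r k i j \<le> q k j + 1" if "i < n" "j < n" for k i j
    using Q that unfolding Q_def by blast
  have s: "q k j \<le> s k i j \<and> s k i j \<le> q k j + 1" if "i < n" "j < n" for k i j
    using Q that unfolding Q_def by blast
  have rs: "label k (r k i) i \<noteq> label k (s k i) i" if "i < n" for k i
    using Q that unfolding Q_def by blast
  have "\<forall>k. pt k (q k) \<in> hilbert_cube"
  proof
    fix k
    have "pt k (q k) i \<in> {0..1}" for i
      using q[of i k] by (cases "i < n") (simp_all add: pt_def divide_le_eq)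
    then show "pt k (q k) \<in> hilbert_cube" by (simp add: hilbert_cube_def)
  qed
  moreover have "seq_compact hilbert_cube"
    using compact_hilbert_cube compact_eq_seq_compact_metric by blast
  ultimately obtain l \<sigma> where l: "l \<in> hilbert_cube" "strict_mono \<sigma>"
    and lim: "((\<lambda>k. pt k (q k)) \<circ> \<sigma>) \<longlonglongrightarrow> l"
    using seq_compactE[of hilbert_cube "\<lambda>k. pt k (q k)"] by blast
  \<comment> \<open>Whichever vertices of the shrinking cells are selected, they converge to the
    same limit as the corners.\<close>
  have lim': "(\<lambda>k. pt (\<sigma> k) (x (\<sigma> k))) \<longlonglongrightarrow> l"
    if x: "\<And>k j. j < n \<Longrightarrow> q k j \<le> x k j \<and> x k j \<le> q k j + 1" for x :: "nat \<Rightarrow> nat \<Rightarrow> nat"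
  proof (rule tendsto_funI)
    fix j
    have 1: "(\<lambda>k. pt (\<sigma> k) (q (\<sigma> k)) j) \<longlonglongrightarrow> l j"
      using continuous_on_tendsto_compose[OF continuous_on_product_coordinates[of j] lim] by (simp add: o_def)
    have 2: "(\<lambda>k. pt (\<sigma> k) (x (\<sigma> k)) j - pt (\<sigma> k) (q (\<sigma> k)) j) \<longlonglongrightarrow> 0"
    proof (rule Lim_null_comparison)
      show "\<forall>\<^sub>F k in sequentially. norm (pt (\<sigma> k) (x (\<sigma> k)) j - pt (\<sigma> k) (q (\<sigma> k)) j) \<le> inverse (real (Suc (\<sigma> k)))"
      proof (rule always_eventually, rule allI)
        fix k
        show "norm (pt (\<sigma> k) (x (\<sigma> k)) j - pt (\<sigma> k) (q (\<sigma> k)) j) \<le> inverse (real (Suc (\<sigma> k)))"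
        proof (cases "j < n")
          case True
          then have "\<bar>real (x (\<sigma> k) j) - real (q (\<sigma> k) j)\<bar> \<le> 1" using x[of j "\<sigma> k"] by linarith
          then have "\<bar>real (x (\<sigma> k) j) - real (q (\<sigma> k) j)\<bar> / real (Suc (\<sigma> k)) \<le> 1 / real (Suc (\<sigma> k))"
            by (intro divide_right_mono) auto
          then show ?thesis using True
            by (simp add: pt_def diff_divide_distrib[symmetric] abs_divide inverse_eq_divide)
        qed (simp add: pt_def)
      qed
      show "(\<lambda>k. inverse (real (Suc (\<sigma> k)))) \<longlonglongrightarrow> 0"
        using LIMSEQ_subseq_LIMSEQ[OF LIMSEQ_inverse_real_of_nat l(2)] by (simp add: o_def)
    qed
    show "(\<lambda>k. pt (\<sigma> k) (x (\<sigma> k)) j) \<longlonglongrightarrow> l j"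
      using tendsto_add[OF 1 2] by simp
  qed
  obtain i where i: "i < n" "l \<in> A i \<union> B i" using C(2) n l(1) by blast
  have R: "(\<lambda>k. pt (\<sigma> k) (r (\<sigma> k) i)) \<longlonglongrightarrow> l" and S: "(\<lambda>k. pt (\<sigma> k) (s (\<sigma> k) i)) \<longlonglongrightarrow> l"
    using lim'[of "\<lambda>k. r k i"] lim'[of "\<lambda>k. s k i"] r[OF i(1)] s[OF i(1)] by auto
  have "\<exists>U\<in>{A i, B i}. l \<in> U \<and> open U" using i op by auto
  then obtain U where U: "U \<in> {A i, B i}" "l \<in> U" "open U" by blast
  have "\<forall>\<^sub>F k in sequentially. pt (\<sigma> k) (r (\<sigma> k) i) \<in> U \<and> pt (\<sigma> k) (s (\<sigma> k) i) \<in> U"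
    using topological_tendstoD[OF R U(3,2)] topological_tendstoD[OF S U(3,2)] by (rule eventually_conj)
  then obtain k where "pt (\<sigma> k) (r (\<sigma> k) i) \<in> U" "pt (\<sigma> k) (s (\<sigma> k) i) \<in> U"
    by (auto simp: eventually_sequentially)
  then have "label (\<sigma> k) (r (\<sigma> k) i) i = label (\<sigma> k) (s (\<sigma> k) i) i"
    using U(1) disj[of i] by (auto simp: label_def)
  then show False using rs[OF i(1)] by blast
qed

text \<open>Complete normality of metric spaces. Radii are halved because two meeting balls of radii
  e/2 and d/2 have centres closer than the larger of e and d, against the choice of that
  radius.\<close>

lemma separate_relatively_open:
  fixes P :: "'a::metric_space set"
  assumes "openin (top_of_set P) U" "openin (top_of_set P) V" "U \<inter> V = {}"
  obtains U' V' where "open U'" "open V'" "U \<subseteq> U'" "V \<subseteq> V'" "U' \<inter> V' = {}"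
proof -
  define U' where "U' = \<Union>{ball u (e/2) | u e. u \<in> U \<and> e > 0 \<and> ball u e \<inter> V = {}}"
  define V' where "V' = \<Union>{ball v (e/2) | v e. v \<in> V \<and> e > 0 \<and> ball v e \<inter> U = {}}"
  have 1: "open U'" "open V'" by (auto simp: U'_def V'_def)
  have sub: "\<exists>e>0. ball u e \<inter> V = {}" if "openin (top_of_set P) U" "openin (top_of_set P) V" "U \<inter> V = {}" "u \<in> U"
    for u and U V :: "'a set"
  proof -
    from that(1) obtain T where T: "open T" "U = P \<inter> T"
      unfolding openin_open by blast
    have "u \<in> T" using T(2) that(4) by blast
    then obtain e where e: "e > 0" "ball u e \<subseteq> T" using T(1) openE by blast
    have "V \<subseteq> P" using openin_imp_subset[OF that(2)] .
    then have "ball u e \<inter> V = {}" using e(2) T(2) that(3) by blast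
    then show ?thesis using e(1) by blast
  qed
  have "U \<subseteq> U'"
  proof
    fix u assume u: "u \<in> U"
    obtain e where "e > 0" "ball u e \<inter> V = {}" using sub[OF assms u] by blast
    moreover from this have "u \<in> ball u (e/2)" by simp
    ultimately show "u \<in> U'" using u unfolding U'_def by blast
  qed
  moreover have "V \<subseteq> V'"
  proof
    fix v assume v: "v \<in> V"
    have "V \<inter> U = {}" using assms(3) by blast
    then obtain e where "e > 0" "ball v e \<inter> U = {}" using sub[OF assms(2,1) _ v] by blast
    moreover from this have "v \<in> ball v (e/2)" by simp
    ultimately show "v \<in> V'" using v unfolding V'_def by blast
  qed
  moreover have False if "x \<in> U'" "x \<in> V'" for x
  proof -
    from that(1) obtain u e where u: "u \<in> U" "e > 0" "ball u e \<inter> V = {}" "dist u x < e/2"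
      by (auto simp: U'_def)
    from that(2) obtain v d where v: "v \<in> V" "d > 0" "ball v d \<inter> U = {}" "dist v x < d/2"
      by (auto simp: V'_def)
    have "dist u v < e/2 + d/2" using u v dist_triangle_less_add[of u x "e/2" v "d/2"] by (simp add: dist_commute)
    moreover have "dist u v \<ge> e" using u v by (force simp: not_le[symmetric])
    moreover have "dist u v \<ge> d" using u v by (force simp: not_le[symmetric] dist_commute)
    ultimately show False by linarith
  qed
  ultimately show ?thesis using that[of U' V'] 1 by blast
qed

section \<open>Refinements by finitely many disjoint families\<close>

text \<open>\<open>\<D> c\<close> is the family of color c. Its members are open in the ambient
  space, so that they can be factors of open sets of pairs, while disjointness and refinement are
  demanded only inside S.\<close>

definition colored_refinement ::
    "nat \<Rightarrow> 'a::topological_space set \<Rightarrow> 'a set set \<Rightarrow> (nat \<Rightarrow> 'a set set) \<Rightarrow> bool" where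
  "colored_refinement N S \<G> \<D> \<longleftrightarrow>
    (\<forall>c<N. \<forall>V\<in>\<D> c. open V \<and> (\<exists>G\<in>\<G>. S \<inter> V \<subseteq> G)) \<and>
    (\<forall>c<N. \<forall>V\<in>\<D> c. \<forall>W\<in>\<D> c. \<forall>x\<in>S. x \<in> V \<longrightarrow> x \<in> W \<longrightarrow> V = W) \<and>
    (\<forall>x\<in>S. \<exists>c<N. \<exists>V\<in>\<D> c. x \<in> V)"

lemma colored_refinementD:
  assumes "colored_refinement N S \<G> \<D>"
  shows "c < N \<Longrightarrow> V \<in> \<D> c \<Longrightarrow> open V"
    and "c < N \<Longrightarrow> V \<in> \<D> c \<Longrightarrow> \<exists>G\<in>\<G>. S \<inter> V \<subseteq> G"
    and "c < N \<Longrightarrow> V \<in> \<D> c \<Longrightarrow> W \<in> \<D> c \<Longrightarrow> x \<in> S \<Longrightarrow> x \<in> V \<Longrightarrow> x \<in> W \<Longrightarrow> V = W"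
    and "x \<in> S \<Longrightarrow> \<exists>c<N. \<exists>V\<in>\<D> c. x \<in> V"
  using assms unfolding colored_refinement_def by simp_all

lemma colored_refinementI:
  assumes "\<And>c V. c < N \<Longrightarrow> V \<in> \<D> c \<Longrightarrow> open V"
    and "\<And>c V. c < N \<Longrightarrow> V \<in> \<D> c \<Longrightarrow> \<exists>G\<in>\<G>. S \<inter> V \<subseteq> G"
    and "\<And>c V W x. c < N \<Longrightarrow> V \<in> \<D> c \<Longrightarrow> W \<in> \<D> c \<Longrightarrow> x \<in> S \<Longrightarrow> x \<in> V \<Longrightarrow> x \<in> W \<Longrightarrow> V = W"
    and "\<And>x. x \<in> S \<Longrightarrow> \<exists>c<N. \<exists>V\<in>\<D> c. x \<in> V"
  shows "colored_refinement N S \<G> \<D>"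
  using assms unfolding colored_refinement_def by simp

text \<open>For metrizable S this is Ostrand's form of covering dimension at most N - 1. It passes
  to products by multiplying the numbers of colors.\<close>

definition colored_refinable :: "nat \<Rightarrow> 'a::topological_space set \<Rightarrow> bool" where
  "colored_refinable N S \<longleftrightarrow>
    (\<forall>\<G>. (\<forall>G\<in>\<G>. open G) \<longrightarrow> S \<subseteq> \<Union>\<G> \<longrightarrow> (\<exists>\<D>. colored_refinement N S \<G> \<D>))"

text \<open>
  Finite-dimensional sets are of this kind. The complement of \<open>{t. \<forall>i\<in>I. t i = c i}\<close> is the union
  of the disjoint pairs \<open>{t. t i < c i}\<close>, \<open>{t. t i > c i}\<close> with \<open>i \<in> I\<close>.
\<close>

definition misses_cube_points :: "(nat \<Rightarrow> real) set \<Rightarrow> bool" where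
  "misses_cube_points T \<longleftrightarrow>
    (\<exists>J. \<forall>I. finite I \<and> card I = J \<longrightarrow>
      (\<exists>c. (\<forall>i\<in>I. 0 < c i \<and> c i < 1) \<and> (\<forall>t\<in>T. \<exists>i\<in>I. t i \<noteq> c i)))"

lemma misses_cube_points_subset:
  assumes "misses_cube_points T" "S \<subseteq> T"
  shows "misses_cube_points S"
proof -
  obtain J where J: "\<forall>I. finite I \<and> card I = J \<longrightarrow>
      (\<exists>c. (\<forall>i\<in>I. 0 < c i \<and> c i < 1) \<and> (\<forall>t\<in>T. \<exists>i\<in>I. t i \<noteq> c i))"
    using assms(1) unfolding misses_cube_points_def by (rule exE)
  have "\<exists>c. (\<forall>i\<in>I. 0 < c i \<and> c i < 1) \<and> (\<forall>t\<in>S. \<exists>i\<in>I. t i \<noteq> c i)" if I: "finite I \<and> card I = J" for I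
  proof -
    obtain c where "\<forall>i\<in>I. 0 < c i \<and> c i < 1" "\<forall>t\<in>T. \<exists>i\<in>I. t i \<noteq> c i"
      using J[rule_format, OF I] by (elim exE conjE)
    moreover from this(2) have "\<forall>t\<in>S. \<exists>i\<in>I. t i \<noteq> c i"
      using assms(2) by (metis subsetD)
    ultimately show ?thesis by (intro exI conjI)
  qed
  then show ?thesis unfolding misses_cube_points_def by (intro exI[of _ J]) simp
qed

definition splits_cube :: "nat \<Rightarrow> (nat \<Rightarrow> real) set \<Rightarrow> (nat \<Rightarrow> real) set \<Rightarrow> bool" where
  "splits_cube i A B \<longleftrightarrow>
    open A \<and> open B \<and> A \<inter> B = {} \<and> (\<forall>t\<in>A. t i \<noteq> 1) \<and> (\<forall>t\<in>B. t i \<noteq> 0)"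

text \<open>All t related to z miss a point \<open>c\<close> on a finite block of coordinates, so
  each of them lies strictly below or above \<open>c\<close> in one of these. By compactness of E
  the same \<open>c\<close> serves all points near z, and a colored refinement of Z makes the local
  choices. Sets of one color are disjoint, so choices for one coordinate never conflict. Where only
  one z is related to t, the resulting open sets of pairs descend to sets of t.\<close>

lemma unique_fibre_cover:
  fixes E :: "((nat \<Rightarrow> real) \<times> 'z::metric_space) set"
  assumes E: "compact E" "E \<subseteq> UNIV \<times> Z" and Z: "colored_refinable N Z"
    and thin: "\<And>z. z \<in> Z \<Longrightarrow> misses_cube_points {t. (t, z) \<in> E}"
    and I: "infinite I"
  shows "\<exists>A B. (\<forall>i. splits_cube i (A i) (B i)) \<and> {t. \<exists>!z. (t, z) \<in> E} \<subseteq> (\<Union>i\<in>I. A i \<union> B i)"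
proof -
  obtain h :: "nat \<Rightarrow> nat" where h: "inj h" "range h \<subseteq> I"
    using infinite_countable_subset[OF I] by blast
  \<comment> \<open>The colors use disjoint sets of coordinates, so sets of different colors never interfere.\<close>
  define \<iota> where "\<iota> \<gamma> k = h (prod_encode (\<gamma>, k))" for \<gamma> k
  have \<iota>I: "\<iota> \<gamma> k \<in> I" for \<gamma> k using h(2) by (auto simp: \<iota>_def)
  have \<iota>_inj: "\<iota> \<gamma> k = \<iota> \<gamma>' k' \<longleftrightarrow> \<gamma> = \<gamma>' \<and> k = k'" for \<gamma> k \<gamma>' k'
    using inj_eq[OF h(1)] by (simp add: \<iota>_def)
  define Q where "Q z \<gamma> J c \<longleftrightarrow> (\<forall>i. 0 < c i \<and> c i < (1::real)) \<and>
      (\<forall>t. (t, z) \<in> E \<longrightarrow> (\<exists>k<J. t (\<iota> \<gamma> k) \<noteq> c (\<iota> \<gamma> k)))" for z \<gamma> and J :: nat and c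
  have "\<exists>J c. Q z \<gamma> J c"
    if z: "z \<in> Z" for z \<gamma>
  proof -
    obtain J where J: "\<forall>I. finite I \<and> card I = J \<longrightarrow>
      (\<exists>c. (\<forall>i\<in>I. 0 < c i \<and> c i < 1) \<and> (\<forall>t\<in>{t. (t, z) \<in> E}. \<exists>i\<in>I. t i \<noteq> c i))"
      using thin[OF z] unfolding misses_cube_points_def by (rule exE)
    have "inj_on (\<iota> \<gamma>) {..<J}" using \<iota>_inj by (auto simp: inj_on_def)
    then have "card (\<iota> \<gamma> ` {..<J}) = J" by (simp add: card_image)
    then obtain c where c: "\<forall>i\<in>\<iota> \<gamma> ` {..<J}. 0 < c i \<and> c i < 1"
        "\<forall>t\<in>{t. (t, z) \<in> E}. \<exists>i\<in>\<iota> \<gamma> ` {..<J}. t i \<noteq> c i"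
      using J[rule_format, of "\<iota> \<gamma> ` {..<J}"] by auto
    \<comment> \<open>The value 1/2 off the block only keeps \<open>c\<close> strictly between 0 and
      1 everywhere.\<close>
    have "Q z \<gamma> J (\<lambda>i. if i \<in> \<iota> \<gamma> ` {..<J} then c i else 1/2)"
    proof -
      have "\<exists>k<J. t (\<iota> \<gamma> k) \<noteq> c (\<iota> \<gamma> k)" if "(t, z) \<in> E" for t
        using bspec[OF c(2), of t] that by auto
      moreover have "(if \<iota> \<gamma> k \<in> \<iota> \<gamma> ` {..<J} then c (\<iota> \<gamma> k) else 1/2) = c (\<iota> \<gamma> k)" if "k < J" for k
        using that by simp
      ultimately have "\<exists>k<J. t (\<iota> \<gamma> k) \<noteq> (if \<iota> \<gamma> k \<in> \<iota> \<gamma> ` {..<J} then c (\<iota> \<gamma> k) else 1/2)"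
        if "(t, z) \<in> E" for t
        using that by metis
      moreover have "0 < (if i \<in> \<iota> \<gamma> ` {..<J} then c i else 1/2) \<and> (if i \<in> \<iota> \<gamma> ` {..<J} then c i else 1/2) < 1" for i
        using bspec[OF c(1), of i] by simp
      ultimately show ?thesis unfolding Q_def by blast
    qed
    then show ?thesis by blast
  qed
  then obtain J c where Q: "\<And>z \<gamma>. z \<in> Z \<Longrightarrow> Q z \<gamma> (J z \<gamma>) (c z \<gamma>)"
    by metis
  have c: "0 < c z \<gamma> i \<and> c z \<gamma> i < 1" if "z \<in> Z" for z \<gamma> i
    using Q[OF that] unfolding Q_def by blast
  have avoid: "\<exists>k<J z \<gamma>. t (\<iota> \<gamma> k) \<noteq> c z \<gamma> (\<iota> \<gamma> k)" if "z \<in> Z" "(t, z) \<in> E" for z \<gamma> t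
    using Q[OF that(1)] that(2) unfolding Q_def by blast
  define O' where "O' z \<gamma> = (\<Union>k<J z \<gamma>. {t::nat \<Rightarrow> real. t (\<iota> \<gamma> k) \<noteq> c z \<gamma> (\<iota> \<gamma> k)})" for z \<gamma>
  have openO: "open (O' z \<gamma>)" for z \<gamma>
    unfolding O'_def by (intro open_UN ballI open_Collect_neq continuous_on_const continuous_on_product_coordinates)
  \<comment> \<open>A point belongs to \<open>G z\<close> if everything related to it lies in
    \<open>O' z \<gamma>\<close>. All colors are treated at once, because the color of the set that
    will cover the point is not yet known. Projections of compact sets are closed, hence
    \<open>G z\<close> is open.\<close>
  define G where "G z = (\<Inter>\<gamma><N. - snd ` (E - O' z \<gamma> \<times> UNIV))" for z
  have openG: "open (G z)" for z
    unfolding G_def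
    by (intro open_INT ballI open_Compl compact_imp_closed compact_continuous_image compact_diff E
        open_Times openO continuous_on_snd continuous_on_id) auto
  have zG: "z \<in> G z" if "z \<in> Z" for z
    using avoid[OF that] unfolding G_def O'_def by force
  have "\<forall>G'\<in>G ` Z. open G'" "Z \<subseteq> \<Union>(G ` Z)"
    using openG zG by blast+
  then obtain \<D> where \<D>0: "colored_refinement N Z (G ` Z) \<D>"
    using Z unfolding colored_refinable_def by blast
  have \<D>: "open V" "\<exists>z. z \<in> Z \<and> Z \<inter> V \<subseteq> G z" if "\<gamma> < N" "V \<in> \<D> \<gamma>" for \<gamma> V
    using colored_refinementD(1,2)[OF \<D>0 that] by auto
  obtain \<zeta> where \<zeta>: "\<And>\<gamma> V. \<gamma> < N \<Longrightarrow> V \<in> \<D> \<gamma> \<Longrightarrow> \<zeta> \<gamma> V \<in> Z \<and> Z \<inter> V \<subseteq> G (\<zeta> \<gamma> V)"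
    using \<D>(2) by metis
  \<comment> \<open>The coordinate i determines its color, and on E the color and z determine V. So
    \<open>AA i\<close> and \<open>BB i\<close> compare \<open>t i\<close> with one and the same
    number there.\<close>
  define AA where "AA i = \<Union>{{t. t i < c (\<zeta> \<gamma> V) \<gamma> i} \<times> V | \<gamma> k V. \<gamma> < N \<and> V \<in> \<D> \<gamma> \<and> i = \<iota> \<gamma> k}" for i
  define BB where "BB i = \<Union>{{t. t i > c (\<zeta> \<gamma> V) \<gamma> i} \<times> V | \<gamma> k V. \<gamma> < N \<and> V \<in> \<D> \<gamma> \<and> i = \<iota> \<gamma> k}" for i
  have openAA: "open (AA i)" and openBB: "open (BB i)" for i
  proof -
    have "open {t::nat \<Rightarrow> real. t i < a}" "open {t::nat \<Rightarrow> real. t i > a}" for a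
      by (intro open_Collect_less continuous_on_const continuous_on_product_coordinates)+
    then have *: "open ({t. t i < c (\<zeta> \<gamma> V) \<gamma> i} \<times> V)" "open ({t. t i > c (\<zeta> \<gamma> V) \<gamma> i} \<times> V)"
      if "\<gamma> < N" "V \<in> \<D> \<gamma>" for \<gamma> V
      using \<D>(1)[OF that] by (simp_all add: open_Times)
    show "open (AA i)" unfolding AA_def by (rule open_Union) (use *(1) in blast)
    show "open (BB i)" unfolding BB_def by (rule open_Union) (use *(2) in blast)
  qed
  have disjAB: "E \<inter> AA i \<inter> BB i = {}" for i
  proof -
    have False if "(t, z) \<in> E" "(t, z) \<in> AA i" "(t, z) \<in> BB i" for t z
    proof -
      from that(2) obtain \<gamma> k V where 1: "\<gamma> < N" "V \<in> \<D> \<gamma>" "i = \<iota> \<gamma> k" "z \<in> V" "t i < c (\<zeta> \<gamma> V) \<gamma> i"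
        unfolding AA_def by blast
      from that(3) obtain \<gamma>' k' W where 2: "\<gamma>' < N" "W \<in> \<D> \<gamma>'" "i = \<iota> \<gamma>' k'" "z \<in> W" "t i > c (\<zeta> \<gamma>' W) \<gamma>' i"
        unfolding BB_def by blast
      have "\<gamma>' = \<gamma>" using 1 2 \<iota>_inj by metis
      moreover have "z \<in> Z" using that(1) E(2) by auto
      ultimately have "V = W" using colored_refinementD(3)[OF \<D>0, of \<gamma> V W z] 1 2 by blast
      then show False using 1 2 \<open>\<gamma>' = \<gamma>\<close> by simp
    qed
    then show ?thesis by auto
  qed
  \<comment> \<open>Removing from P the projection of E - X leaves the t whose only related pair
    lies in X. This is relatively open for open X since E - X is compact.\<close>
  define P where "P = {t. \<exists>!z. (t, z) \<in> E}"
  have rel_open: "openin (top_of_set P) (P - fst ` (E - X))" if "open X" for X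
  proof -
    have "closed (fst ` (E - X))"
      by (intro compact_imp_closed compact_continuous_image compact_diff E that continuous_on_fst continuous_on_id)
    then have "open (- fst ` (E - X))" by auto
    moreover have "P - fst ` (E - X) = P \<inter> (- fst ` (E - X))" by blast
    ultimately show ?thesis using openin_open by blast
  qed
  have "\<exists>U V. open U \<and> open V \<and> P - fst ` (E - AA i) \<subseteq> U \<and> P - fst ` (E - BB i) \<subseteq> V \<and> U \<inter> V = {}" for i
  proof -
    have "(P - fst ` (E - AA i)) \<inter> (P - fst ` (E - BB i)) = {}"
    proof -
      have False if t: "t \<in> P" "t \<notin> fst ` (E - AA i)" "t \<notin> fst ` (E - BB i)" for t
      proof -
        obtain z where z: "(t, z) \<in> E" using t(1) unfolding P_def by blast
        then have "(t, z) \<in> AA i" "(t, z) \<in> BB i" using t(2,3) by force+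
        then show False using z disjAB by blast
      qed
      then show ?thesis by blast
    qed
    then show ?thesis
      using separate_relatively_open[OF rel_open[OF openAA] rel_open[OF openBB]] by metis
  qed
  then obtain A B where AB: "\<And>i. open (A i)" "\<And>i. open (B i)" "\<And>i. P - fst ` (E - AA i) \<subseteq> A i"
      "\<And>i. P - fst ` (E - BB i) \<subseteq> B i" "\<And>i. A i \<inter> B i = {}"
    by metis
  \<comment> \<open>Trimming away the forbidden faces is harmless: the sets are applied only to t
    with \<open>t i\<close> below some number less than 1, or above some positive number.\<close>
  define A' where "A' i = A i \<inter> {t. t i < 1}" for i
  define B' where "B' i = B i \<inter> {t. t i > 0}" for i
  have "splits_cube i (A' i) (B' i)" for i
  proof -
    have "open {t::nat \<Rightarrow> real. t i < 1}" "open {t::nat \<Rightarrow> real. t i > 0}"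
      by (intro open_Collect_less continuous_on_const continuous_on_product_coordinates)+
    then show ?thesis
      using AB(5)[of i] open_Int[OF AB(1)[of i]] open_Int[OF AB(2)[of i]]
      unfolding splits_cube_def A'_def B'_def by auto
  qed
  moreover have "P \<subseteq> (\<Union>i\<in>I. A' i \<union> B' i)"
  proof
    fix t assume t: "t \<in> P"
    obtain z where z: "(t, z) \<in> E" "\<And>z'. (t, z') \<in> E \<Longrightarrow> z' = z"
      using t unfolding P_def by blast
    have zZ: "z \<in> Z" using z(1) E(2) by auto
    then obtain \<gamma> V where V: "\<gamma> < N" "V \<in> \<D> \<gamma>" "z \<in> V" using colored_refinementD(4)[OF \<D>0] by blast
    have "z \<in> G (\<zeta> \<gamma> V)" using \<zeta>[OF V(1,2)] V zZ by blast
    then have "z \<notin> snd ` (E - O' (\<zeta> \<gamma> V) \<gamma> \<times> UNIV)" using V(1) unfolding G_def by blast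
    then have "t \<in> O' (\<zeta> \<gamma> V) \<gamma>" using z(1) by force
    then obtain k where k: "t (\<iota> \<gamma> k) \<noteq> c (\<zeta> \<gamma> V) \<gamma> (\<iota> \<gamma> k)" unfolding O'_def by blast
    define i where "i = \<iota> \<gamma> k"
    have c1: "0 < c (\<zeta> \<gamma> V) \<gamma> i" "c (\<zeta> \<gamma> V) \<gamma> i < 1" using c \<zeta>[OF V(1,2)] by auto
    have "t \<in> A' i \<union> B' i"
    proof (cases "t i < c (\<zeta> \<gamma> V) \<gamma> i")
      case True
      then have "(t, z) \<in> AA i" unfolding AA_def using V i_def by blast
      then have "t \<notin> fst ` (E - AA i)" using z by force
      then have "t \<in> A i" using AB(3) t by blast
      then show ?thesis using True c1 unfolding A'_def by auto
    next
      case False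
      then have gt: "t i > c (\<zeta> \<gamma> V) \<gamma> i" using k i_def by auto
      then have "(t, z) \<in> BB i" unfolding BB_def using V i_def by blast
      then have "t \<notin> fst ` (E - BB i)" using z by force
      then have "t \<in> B i" using AB(4) t by blast
      then show ?thesis using gt c1 unfolding B'_def by auto
    qed
    then show "t \<in> (\<Union>i\<in>I. A' i \<union> B' i)" using \<iota>I i_def by blast
  qed
  ultimately show ?thesis unfolding P_def by blast
qed

text \<open>The coordinates in \<open>I p\<close> are reserved for the piece \<open>E p\<close>. As
  these sets are disjoint, the pair with index i can be taken from the one piece that owns i, and
  the pairs together still cover the cube.\<close>

lemma hilbert_cube_not_covered_by_unique_fibres:
  fixes E :: "nat \<Rightarrow> ((nat \<Rightarrow> real) \<times> 'z::metric_space) set"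
  assumes E: "\<And>p. compact (E p)" "\<And>p. E p \<subseteq> UNIV \<times> Z p"
    and Z: "\<And>p. colored_refinable (N p) (Z p)"
    and thin: "\<And>p z. z \<in> Z p \<Longrightarrow> misses_cube_points {t. (t, z) \<in> E p}"
    and unique: "\<And>t. t \<in> hilbert_cube \<Longrightarrow> \<exists>p. \<exists>!z. (t, z) \<in> E p"
  shows False
proof -
  define I where "I p = range (\<lambda>k. prod_encode (p, k))" for p
  have "infinite (I p)" for p
    unfolding I_def by (rule range_inj_infinite) (auto simp: inj_on_def)
  then have "\<exists>A B. (\<forall>i. splits_cube i (A i) (B i)) \<and> {t. \<exists>!z. (t, z) \<in> E p} \<subseteq> (\<Union>i\<in>I p. A i \<union> B i)" for p
    using unique_fibre_cover[OF E(1)[of p] E(2)[of p] Z[of p] thin[of _ p]] by blast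
  then have "\<forall>p. \<exists>A B. (\<forall>i. splits_cube i (A i) (B i)) \<and> {t. \<exists>!z. (t, z) \<in> E p} \<subseteq> (\<Union>i\<in>I p. A i \<union> B i)"
    by (rule allI)
  then obtain A where "\<forall>p. \<exists>B. (\<forall>i. splits_cube i (A p i) (B i)) \<and>
      {t. \<exists>!z. (t, z) \<in> E p} \<subseteq> (\<Union>i\<in>I p. A p i \<union> B i)"
    by (rule choice[THEN exE])
  then obtain B where AB: "\<forall>p. (\<forall>i. splits_cube i (A p i) (B p i)) \<and>
      {t. \<exists>!z. (t, z) \<in> E p} \<subseteq> (\<Union>i\<in>I p. A p i \<union> B p i)"
    by (rule choice[THEN exE])
  have split: "splits_cube i (A p i) (B p i)" for p i
    using AB[THEN spec[of _ p], THEN conjunct1] by (rule spec)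
  have cover: "{t. \<exists>!z. (t, z) \<in> E p} \<subseteq> (\<Union>i\<in>I p. A p i \<union> B p i)" for p
    using AB[THEN spec[of _ p], THEN conjunct2] .
  define p where "p i = fst (prod_decode i)" for i
  show False
  proof (rule hilbert_cube_no_disjoint_cover[of "\<lambda>i. A (p i) i" "\<lambda>i. B (p i) i"])
    show "hilbert_cube \<subseteq> (\<Union>i. A (p i) i \<union> B (p i) i)"
    proof
      fix t assume "t \<in> hilbert_cube"
      then obtain q where "\<exists>!z. (t, z) \<in> E q" using unique by blast
      then obtain i where "i \<in> I q" "t \<in> A q i \<union> B q i" using cover[of q] by blast
      moreover from this have "p i = q" by (auto simp: p_def I_def)
      ultimately show "t \<in> (\<Union>i. A (p i) i \<union> B (p i) i)" by blast
    qed
  qed (use split in \<open>simp_all add: splits_cube_def\<close>)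
qed

text \<open>A point isolated among those related to t becomes the only one after intersecting with
  the closure of a small basic set. Closures keep the pieces compact, and a countable base keeps
  them countable in number.\<close>

lemma hilbert_cube_not_covered_by_isolated_fibres:
  fixes E :: "nat \<Rightarrow> ((nat \<Rightarrow> real) \<times> 'z::{metric_space, second_countable_topology}) set"
  assumes E: "\<And>p. compact (E p)" "\<And>p. E p \<subseteq> UNIV \<times> Z p"
    and Z: "\<And>p. colored_refinable (N p) (Z p)"
    and thin: "\<And>p z. z \<in> Z p \<Longrightarrow> misses_cube_points {t. (t, z) \<in> E p}"
    and isolated: "\<And>t. t \<in> hilbert_cube \<Longrightarrow> \<exists>p z U. open U \<and> z \<in> U \<and> {z' \<in> U. (t, z') \<in> E p} = {z}"
  shows False
proof -
  obtain \<B> :: "'z set set" where \<B>: "countable \<B>" "topological_basis \<B>"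
    using ex_countable_basis by blast
  define b where "b = from_nat_into \<B>"
  define F where "F r = E (fst (prod_decode r)) \<inter> (UNIV \<times> closure (b (snd (prod_decode r))))" for r
  show False
  proof (rule hilbert_cube_not_covered_by_unique_fibres
      [of F "\<lambda>r. Z (fst (prod_decode r))" "\<lambda>r. N (fst (prod_decode r))"])
    show "compact (F r)" for r
      unfolding F_def by (intro compact_Int_closed E closed_Times) auto
    show "F r \<subseteq> UNIV \<times> Z (fst (prod_decode r))" for r
      unfolding F_def using E(2) by blast
    show "misses_cube_points {t. (t, z) \<in> F r}" if "z \<in> Z (fst (prod_decode r))" for r z
      by (rule misses_cube_points_subset[OF thin[OF that]]) (auto simp: F_def)
    show "\<exists>r. \<exists>!z. (t, z) \<in> F r" if "t \<in> hilbert_cube" for t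
    proof -
      from isolated[OF that] obtain p z U where U: "open U" "z \<in> U" "{z' \<in> U. (t, z') \<in> E p} = {z}"
        by blast
      obtain e where e: "e > 0" "cball z e \<subseteq> U" using U open_contains_cball by blast
      obtain V where V: "V \<in> \<B>" "z \<in> V" "V \<subseteq> ball z e"
        using e(1) by (auto intro: topological_basisE[OF \<B>(2) open_ball[of z e], of z])
      have "closure V \<subseteq> cball z e"
        using V(3) ball_subset_cball[of z e] by (intro closure_minimal) auto
      then have clV: "closure V \<subseteq> U" "z \<in> closure V"
        using V(2) e(2) closure_subset[of V] by auto
      obtain j where j: "b j = V" using from_nat_into_surj[OF \<B>(1) V(1)] unfolding b_def by blast
      have "(t, z') \<in> F (prod_encode (p, j)) \<longleftrightarrow> z' = z" for z'
      proof -
        have "z' \<in> U \<and> (t, z') \<in> E p \<longleftrightarrow> z' = z"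
          using eqset_imp_iff[OF U(3), of z'] by simp
        then show ?thesis using clV j by (auto simp: F_def)
      qed
      then show ?thesis by (intro exI[of _ "prod_encode (p, j)"] ex1I[of _ z]) simp_all
    qed
  qed (rule Z)
qed

section \<open>Finite-dimensional compact spaces\<close>

lemma colored_refinableI:
  assumes "\<And>\<G>. \<forall>G\<in>\<G>. open G \<Longrightarrow> S \<subseteq> \<Union>\<G> \<Longrightarrow> \<exists>\<D>. colored_refinement N S \<G> \<D>"
  shows "colored_refinable N S"
  using assms unfolding colored_refinable_def by simp

lemma colored_refinable_singleton: "colored_refinable 1 {x}"
proof (rule colored_refinableI)
  fix \<G> assume \<G>: "\<forall>G\<in>\<G>. open G" "{x} \<subseteq> \<Union>\<G>"
  then obtain G where "G \<in> \<G>" "x \<in> G" by blast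
  have "colored_refinement 1 {x} \<G> (\<lambda>_. {G})"
    unfolding colored_refinement_def
  proof (intro conjI allI ballI impI)
    show "open V" if "V \<in> {G}" for V using that \<open>G \<in> \<G>\<close> \<G>(1) by simp
    show "\<exists>G'\<in>\<G>. {x} \<inter> V \<subseteq> G'" if "V \<in> {G}" for V using that \<open>G \<in> \<G>\<close> by blast
    show "V = W" if "V \<in> {G}" "W \<in> {G}" for V W using that by simp
    show "\<exists>c<(1::nat). \<exists>V\<in>{G}. y \<in> V" if "y \<in> {x}" for y using that \<open>x \<in> G\<close> by (intro exI[of _ 0]) simp
  qed
  then show "\<exists>\<D>. colored_refinement 1 {x} \<G> \<D>" by blast
qed

text \<open>Covers are pulled back along f and the refinement is pulled back along h;
  \<open>f (h y) = y\<close> returns it to the original cover.\<close>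

lemma colored_refinable_homeomorphic:
  fixes f :: "'a::topological_space \<Rightarrow> 'b::topological_space"
  assumes S: "colored_refinable N S"
    and f: "continuous_on UNIV f" "f ` S \<subseteq> T"
    and h: "continuous_on UNIV h" "h ` T \<subseteq> S"
    and fh: "\<And>y. y \<in> T \<Longrightarrow> f (h y) = y"
  shows "colored_refinable N T"
proof (rule colored_refinableI)
  fix \<G> :: "'b set set" assume \<G>: "\<forall>G\<in>\<G>. open G" "T \<subseteq> \<Union>\<G>"
  have "\<forall>G'\<in>(\<lambda>G. f -` G) ` \<G>. open G'"
    using \<G>(1) f(1) by (auto intro: open_vimage)
  moreover have "S \<subseteq> \<Union>((\<lambda>G. f -` G) ` \<G>)"
    using f(2) \<G>(2) by blast
  ultimately obtain \<D> where "colored_refinement N S ((\<lambda>G. f -` G) ` \<G>) \<D>"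
    using S unfolding colored_refinable_def by blast
  note D = colored_refinementD[OF this]
  define \<D>' where "\<D>' c = (\<lambda>V. h -` V) ` \<D> c" for c
  have refine: "open V \<and> (\<exists>G\<in>\<G>. T \<inter> V \<subseteq> G)" if c: "c < N" and V: "V \<in> \<D>' c" for c V
  proof -
    obtain V' where V': "V' \<in> \<D> c" "V = h -` V'" using V unfolding \<D>'_def by blast
    obtain G where G: "G \<in> \<G>" "S \<inter> V' \<subseteq> f -` G" using D(2)[OF c V'(1)] by blast
    have "y \<in> G" if "y \<in> T" "y \<in> V" for y
    proof -
      have "h y \<in> f -` G" using that V'(2) G(2) h(2) by blast
      then show ?thesis using fh[OF that(1)] by simp
    qed
    then have "T \<inter> V \<subseteq> G" by blast
    moreover have "open V" using D(1)[OF c V'(1)] V'(2) h(1) by (simp add: open_vimage)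
    ultimately show ?thesis using G(1) by blast
  qed
  have disjoint: "V = W" if c: "c < N" and V: "V \<in> \<D>' c" "W \<in> \<D>' c" "y \<in> T" "y \<in> V" "y \<in> W" for c V W y
  proof -
    obtain V' W' where V': "V' \<in> \<D> c" "V = h -` V'" "W' \<in> \<D> c" "W = h -` W'"
      using V(1,2) unfolding \<D>'_def by blast
    have "V' = W'" using D(3)[OF c V'(1,3), of "h y"] V V' h(2) by blast
    then show ?thesis using V' by simp
  qed
  have cover: "\<exists>c<N. \<exists>V\<in>\<D>' c. y \<in> V" if "y \<in> T" for y
  proof -
    have "h y \<in> S" using that h(2) by blast
    then obtain c V where "c < N" "V \<in> \<D> c" "h y \<in> V" using D(4) by blast
    then show ?thesis unfolding \<D>'_def by blast
  qed
  have "colored_refinement N T \<G> \<D>'"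
  proof (rule colored_refinementI)
    fix c V assume "c < N" "V \<in> \<D>' c"
    then show "open V" "\<exists>G\<in>\<G>. T \<inter> V \<subseteq> G" using refine by blast+
  next
    fix c V W x assume "c < N" "V \<in> \<D>' c" "W \<in> \<D>' c" "x \<in> T" "x \<in> V" "x \<in> W"
    then show "V = W" by (rule disjoint)
  next
    fix x assume "x \<in> T"
    then show "\<exists>c<N. \<exists>V\<in>\<D>' c. x \<in> V" by (rule cover)
  qed
  then show "\<exists>\<D>. colored_refinement N T \<G> \<D>" by blast
qed

text \<open>With a Lebesgue number e of the cover, it suffices to refine both factors into subsets
  of balls of radius e/2, since the product distance is at most the sum of the two distances. The
  colors a and b combine to the color a * M + b.\<close>

lemma colored_refinable_Times:
  fixes S :: "'a::metric_space set" and T :: "'b::metric_space set"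
  assumes S: "colored_refinable N S" and T: "colored_refinable M T" and "compact S" "compact T"
  shows "colored_refinable (N * M) (S \<times> T)"
proof (rule colored_refinableI)
  fix \<G> :: "('a \<times> 'b) set set" assume \<G>: "\<forall>G\<in>\<G>. open G" "S \<times> T \<subseteq> \<Union>\<G>"
  obtain e where e: "e > 0" "\<And>p. p \<in> S \<times> T \<Longrightarrow> \<exists>G\<in>\<G>. ball p e \<subseteq> G"
    using Heine_Borel_lemma[OF compact_Times[OF assms(3,4)] \<G>(2) bspec[OF \<G>(1)]] by blast
  have "\<forall>G\<in>(\<lambda>x. ball x (e/2)) ` S. open G" "S \<subseteq> \<Union>((\<lambda>x. ball x (e/2)) ` S)"
    using e(1) by auto
  then obtain \<D> where "colored_refinement N S ((\<lambda>x. ball x (e/2)) ` S) \<D>"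
    using S unfolding colored_refinable_def by blast
  note D = colored_refinementD[OF this]
  have "\<forall>G\<in>(\<lambda>x. ball x (e/2)) ` T. open G" "T \<subseteq> \<Union>((\<lambda>x. ball x (e/2)) ` T)"
    using e(1) by auto
  then obtain \<E> where "colored_refinement M T ((\<lambda>x. ball x (e/2)) ` T) \<E>"
    using T unfolding colored_refinable_def by blast
  note E = colored_refinementD[OF this]
  define \<F> where "\<F> c = (\<lambda>(V, W). V \<times> W) ` (\<D> (c div M) \<times> \<E> (c mod M))" for c
  have div: "c div M < N" and mod: "c mod M < M" if "c < N * M" for c
  proof -
    show "c div M < N" using that by (rule less_mult_imp_div_less)
    show "c mod M < M" using that by (cases "M = 0") auto
  qed
  have refine: "open X \<and> (\<exists>G\<in>\<G>. S \<times> T \<inter> X \<subseteq> G)" if c: "c < N * M" and X: "X \<in> \<F> c" for c X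
  proof -
    obtain V W where VW: "X = V \<times> W" "V \<in> \<D> (c div M)" "W \<in> \<E> (c mod M)"
      using X by (auto simp: \<F>_def)
    obtain x where x: "x \<in> S" "S \<inter> V \<subseteq> ball x (e/2)" using D(2)[OF div[OF c] VW(2)] by (elim bexE imageE) simp
    obtain y where y: "y \<in> T" "T \<inter> W \<subseteq> ball y (e/2)" using E(2)[OF mod[OF c] VW(3)] by (elim bexE imageE) simp
    have "(x, y) \<in> S \<times> T" using x(1) y(1) by simp
    then have "\<exists>G\<in>\<G>. ball (x, y) e \<subseteq> G" by (rule e(2))
    then obtain G where G: "G \<in> \<G>" "ball (x, y) e \<subseteq> G" by (rule bexE)
    have "(u, v) \<in> G" if "u \<in> S" "v \<in> T" "u \<in> V" "v \<in> W" for u v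
    proof -
      have "dist x u < e/2" "dist y v < e/2" using that x(2) y(2) by (meson IntI mem_ball subsetD)+
      then have "dist (x, y) (u, v) < e"
        unfolding dist_Pair_Pair using real_sqrt_sum_squares_triangle_ineq[of "dist x u" 0 0 "dist y v"] by simp
      then show ?thesis using G(2) by auto
    qed
    then have "S \<times> T \<inter> X \<subseteq> G" using VW(1) by auto
    moreover have "open X" using D(1)[OF div[OF c] VW(2)] E(1)[OF mod[OF c] VW(3)] VW(1) by (simp add: open_Times)
    ultimately show ?thesis using G(1) by blast
  qed
  have disjoint: "X = Y" if c: "c < N * M" and X: "X \<in> \<F> c" and Y: "Y \<in> \<F> c"
      and p: "p \<in> S \<times> T" "p \<in> X" "p \<in> Y" for c X Y p
  proof -
    obtain V W where VW: "X = V \<times> W" "V \<in> \<D> (c div M)" "W \<in> \<E> (c mod M)"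
      using X by (auto simp: \<F>_def)
    obtain V' W' where VW': "Y = V' \<times> W'" "V' \<in> \<D> (c div M)" "W' \<in> \<E> (c mod M)"
      using Y by (auto simp: \<F>_def)
    have "V = V'" using D(3)[OF div[OF c] VW(2) VW'(2), of "fst p"] p VW(1) VW'(1) by auto
    moreover have "W = W'" using E(3)[OF mod[OF c] VW(3) VW'(3), of "snd p"] p VW(1) VW'(1) by auto
    ultimately show ?thesis using VW(1) VW'(1) by simp
  qed
  have cover: "\<exists>c<N * M. \<exists>X\<in>\<F> c. p \<in> X" if p: "p \<in> S \<times> T" for p
  proof -
    obtain x y where xy: "p = (x, y)" "x \<in> S" "y \<in> T" using p by blast
    obtain a V where a: "a < N" "V \<in> \<D> a" "x \<in> V" using D(4)[OF xy(2)] by blast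
    obtain b W where b: "b < M" "W \<in> \<E> b" "y \<in> W" using E(4)[OF xy(3)] by blast
    have "a * M + b < Suc a * M" using b(1) by simp
    also have "\<dots> \<le> N * M" using a(1) by (intro mult_le_mono1) simp
    finally have "a * M + b < N * M" .
    moreover have "V \<times> W \<in> \<F> (a * M + b)" unfolding \<F>_def using a(2) b(1,2) by auto
    moreover have "p \<in> V \<times> W" using xy a b by simp
    ultimately show ?thesis by (intro exI[of _ "a * M + b"] conjI bexI[of _ "V \<times> W"])
  qed
  have "colored_refinement (N * M) (S \<times> T) \<G> \<F>"
  proof (rule colored_refinementI)
    fix c V assume "c < N * M" "V \<in> \<F> c"
    then show "open V" "\<exists>G\<in>\<G>. S \<times> T \<inter> V \<subseteq> G" using refine by blast+
  next
    fix c V W x assume "c < N * M" "V \<in> \<F> c" "W \<in> \<F> c" "x \<in> S \<times> T" "x \<in> V" "x \<in> W"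
    then show "V = W" by (rule disjoint)
  next
    fix x assume "x \<in> S \<times> T"
    then show "\<exists>c<N * M. \<exists>V\<in>\<F> c. x \<in> V" by (rule cover)
  qed
  then show "\<exists>\<D>. colored_refinement (N * M) (S \<times> T) \<G> \<D>" by blast
qed

text \<open>Padding with \<open>b\<close> puts the tuples of all lengths into one type.\<close>

definition tuples :: "nat \<Rightarrow> 'a set \<Rightarrow> 'a \<Rightarrow> (nat \<Rightarrow> 'a) set" where
  "tuples m S b = {z. (\<forall>i<m. z i \<in> S) \<and> (\<forall>i\<ge>m. z i = b)}"

lemma mem_tuples: "z \<in> tuples m S b \<longleftrightarrow> (\<forall>i<m. z i \<in> S) \<and> (\<forall>i\<ge>m. z i = b)"
  by (simp add: tuples_def)

lemma compact_tuples:
  fixes S :: "'a::topological_space set"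
  assumes "compact S"
  shows "compact (tuples m S b)"
proof -
  have "z \<in> tuples m S b \<longleftrightarrow> z \<in> Pi UNIV (\<lambda>i. if i < m then S else {b})" for z
  proof
    assume z: "z \<in> tuples m S b"
    show "z \<in> Pi UNIV (\<lambda>i. if i < m then S else {b})"
    proof (rule Pi_I)
      show "z i \<in> (if i < m then S else {b})" for i
        using z by (cases "i < m") (simp_all add: mem_tuples)
    qed
  next
    assume "z \<in> Pi UNIV (\<lambda>i. if i < m then S else {b})"
    then have z: "z i \<in> (if i < m then S else {b})" for i
      by (rule Pi_mem) simp
    show "z \<in> tuples m S b"
      unfolding mem_tuples
    proof (intro conjI allI impI)
      show "z i \<in> S" if "i < m" for i using z[of i] that by simp
      show "z i = b" if "m \<le> i" for i using z[of i] that by simp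
    qed
  qed
  then have "tuples m S b = Pi UNIV (\<lambda>i. if i < m then S else {b})" by (rule set_eqI)
  then show ?thesis using assms by (simp add: compact_Pi_UNIV)
qed

text \<open>The number of colors may grow with m, because tuples of different lengths belong to
  different pieces of the final cover.\<close>

lemma colored_refinable_tuples:
  fixes S :: "'a::metric_space set"
  assumes S: "colored_refinable N S" "compact S"
  shows "colored_refinable (N ^ m) (tuples m S b)"
proof (induction m)
  case 0
  have "z = (\<lambda>_. b)" if "z \<in> tuples 0 S b" for z
    using that unfolding mem_tuples by (intro ext) simp
  moreover have "(\<lambda>_. b) \<in> tuples 0 S b"
    unfolding mem_tuples by simp
  ultimately have "tuples 0 S b = {\<lambda>_. b}" by blast
  show ?case unfolding power_0 \<open>tuples 0 S b = {\<lambda>_. b}\<close> by (rule colored_refinable_singleton)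
next
  case (Suc m)
  define f :: "(nat \<Rightarrow> 'a) \<times> 'a \<Rightarrow> nat \<Rightarrow> 'a" where "f = (\<lambda>(z, x). z(m := x))"
  define h :: "(nat \<Rightarrow> 'a) \<Rightarrow> (nat \<Rightarrow> 'a) \<times> 'a" where "h = (\<lambda>z. (z(m := b), z m))"
  have coord: "continuous_on UNIV (\<lambda>z::nat \<Rightarrow> 'a. z i)" for i
    by (rule continuous_on_product_coordinates)
  have upd: "continuous_on UNIV (\<lambda>z::nat \<Rightarrow> 'a. z(m := b))"
  proof (rule continuous_on_coordinatewise_then_product)
    show "continuous_on UNIV (\<lambda>z::nat \<Rightarrow> 'a. (z(m := b)) i)" for i
      using coord[of i] continuous_on_const[of UNIV b] unfolding fun_upd_apply by (cases "i = m") simp_all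
  qed
  have "colored_refinable (N ^ m * N) (tuples (Suc m) S b)"
  proof (rule colored_refinable_homeomorphic[OF colored_refinable_Times[OF Suc S(1) compact_tuples[OF S(2)] S(2)], of f _ h])
    show "continuous_on UNIV f"
    proof (rule continuous_on_coordinatewise_then_product)
      fix i
      have f_eq: "(\<lambda>p. f p i) = (if i = m then (\<lambda>p. snd p) else (\<lambda>p. fst p i))"
        by (auto simp: f_def fun_eq_iff)
      have "continuous_on UNIV (\<lambda>p::(nat \<Rightarrow> 'a) \<times> 'a. fst p i)"
        by (rule continuous_on_compose2[OF coord continuous_on_fst[OF continuous_on_id]]) simp
      then show "continuous_on UNIV (\<lambda>p. f p i)"
        unfolding f_eq using continuous_on_snd[OF continuous_on_id] by (cases "i = m") simp_all
    qed
    show "continuous_on UNIV h"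
      unfolding h_def by (rule continuous_on_Pair[OF upd coord])
    show "f ` (tuples m S b \<times> S) \<subseteq> tuples (Suc m) S b"
    proof
      fix w assume "w \<in> f ` (tuples m S b \<times> S)"
      then obtain z x where w: "w = z(m := x)" and z: "z \<in> tuples m S b" and x: "x \<in> S"
        by (auto simp: f_def)
      show "w \<in> tuples (Suc m) S b"
        unfolding mem_tuples
      proof (intro conjI allI impI)
        show "w i \<in> S" if "i < Suc m" for i
          using z x that by (cases "i = m") (simp_all add: w mem_tuples)
        show "w i = b" if "Suc m \<le> i" for i
          using z that by (simp add: w mem_tuples)
      qed
    qed
    show "h ` tuples (Suc m) S b \<subseteq> tuples m S b \<times> S"
    proof
      fix w assume "w \<in> h ` tuples (Suc m) S b"
      then obtain z where w: "w = (z(m := b), z m)" and z: "z \<in> tuples (Suc m) S b"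
        by (auto simp: h_def)
      have "(z(m := b)) i \<in> S" if "i < m" for i using z that by (simp add: mem_tuples)
      moreover have "(z(m := b)) i = b" if "m \<le> i" for i
        using z that by (cases "i = m") (simp_all add: mem_tuples)
      ultimately have "z(m := b) \<in> tuples m S b" unfolding mem_tuples by blast
      moreover have "z m \<in> S" using z by (simp add: mem_tuples)
      ultimately show "w \<in> tuples m S b \<times> S" by (simp add: w)
    qed
    show "f (h z) = z" for z by (simp add: f_def h_def)
  qed
  then show ?case by (simp add: mult.commute)
qed

section \<open>Colored refinements by cozero sets\<close>

lemma urysohn_function:
  fixes x :: "'a::t1_space"
  assumes "normal_space (euclidean :: 'a topology)" and "open V" and "x \<in> V"
  obtains u :: "'a \<Rightarrow> real" where "continuous_on UNIV u" "\<And>y. 0 \<le> u y" "0 < u x" "\<And>y. 0 < u y \<Longrightarrow> y \<in> V"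
proof -
  have "closedin euclidean (- V)" "closedin euclidean {x}" "disjnt (- V) {x}"
    using assms(2,3) by (auto simp: disjnt_def)
  then obtain f where f: "continuous_map euclidean (top_of_set {0..1::real}) f" "f ` (- V) \<subseteq> {0}" "f ` {x} \<subseteq> {1}"
    using Urysohn_lemma[OF assms(1), of "- V" "{x}" 0 1] by (metis zero_le_one)
  show ?thesis
  proof (rule that[of f])
    show "continuous_on UNIV f" using f(1) by (simp add: continuous_map_in_subtopology)
    have "f y \<in> {0..1}" for y using continuous_map_image_subset_topspace[OF f(1)] by (simp add: image_subset_iff)
    then show "0 \<le> f y" for y by simp
    show "0 < f x" using f(3) by simp
    show "y \<in> V" if "0 < f y" for y using f(2) that by (cases "y \<in> V") auto
  qed
qed

text \<open>Finitely many Urysohn bumps, each inside a chosen member of the cover, are jointly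
  positive everywhere; \<open>\<phi> V\<close> adds up those assigned to V.\<close>

lemma partition_functions:
  fixes \<V> :: "'a::t1_space set set"
  assumes normal: "normal_space (euclidean :: 'a topology)" and comp: "compact (UNIV :: 'a set)"
    and \<V>: "finite \<V>" "\<And>V. V \<in> \<V> \<Longrightarrow> open V" "\<Union>\<V> = UNIV"
  shows "\<exists>\<phi>. (\<forall>V. continuous_on UNIV (\<phi> V) \<and> (\<forall>y. 0 \<le> \<phi> V y) \<and> (\<forall>y. 0 < \<phi> V y \<longrightarrow> y \<in> V)) \<and>
    (\<forall>y. \<exists>V\<in>\<V>. (0::real) < \<phi> V y)"
proof -
  have "\<forall>x. \<exists>V. V \<in> \<V> \<and> x \<in> V" using eqset_imp_iff[OF \<V>(3)] by (simp add: Bex_def)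
  then obtain W where "\<forall>x. W x \<in> \<V> \<and> x \<in> W x" by (rule choice[THEN exE])
  then have W: "W x \<in> \<V>" "x \<in> W x" for x by simp_all
  have "\<exists>u::'a \<Rightarrow> real. continuous_on UNIV u \<and> (\<forall>y. 0 \<le> u y) \<and> 0 < u x \<and> (\<forall>y. 0 < u y \<longrightarrow> y \<in> W x)" for x
  proof -
    obtain u :: "'a \<Rightarrow> real" where "continuous_on UNIV u" "\<And>y. 0 \<le> u y" "0 < u x" "\<And>y. 0 < u y \<Longrightarrow> y \<in> W x"
      by (rule urysohn_function[OF normal \<V>(2)[OF W(1)] W(2)]) (rule that)
    then show ?thesis by (intro exI[of _ u]) simp
  qed
  then have "\<forall>x. \<exists>u::'a \<Rightarrow> real. continuous_on UNIV u \<and> (\<forall>y. 0 \<le> u y) \<and> 0 < u x \<and> (\<forall>y. 0 < u y \<longrightarrow> y \<in> W x)"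
    by (rule allI)
  then obtain u :: "'a \<Rightarrow> 'a \<Rightarrow> real" where
    "\<forall>x. continuous_on UNIV (u x) \<and> (\<forall>y. 0 \<le> u x y) \<and> 0 < u x x \<and> (\<forall>y. 0 < u x y \<longrightarrow> y \<in> W x)"
    by (rule choice[THEN exE])
  then have u: "continuous_on UNIV (u x)" "0 \<le> u x y" "0 < u x x" "0 < u x y \<Longrightarrow> y \<in> W x" for x y
    by simp_all
  have "open {y. 0 < u x y}" for x
    by (intro open_Collect_less continuous_on_const u)
  moreover have "UNIV \<subseteq> (\<Union>x. {y. 0 < u x y})" using u(3) by (intro subsetI UN_I) auto
  ultimately obtain Y where Y: "finite Y" "UNIV \<subseteq> (\<Union>x\<in>Y. {y. 0 < u x y})"
    using compactE_image[OF comp, of UNIV "\<lambda>x. {y. 0 < u x y}"] by metis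
  define \<phi> where "\<phi> V y = (\<Sum>x\<in>{x\<in>Y. W x = V}. u x y)" for V y
  have fin: "finite {x\<in>Y. W x = V}" for V using Y(1) by simp
  have "continuous_on UNIV (\<phi> V)" for V
    unfolding \<phi>_def by (intro continuous_on_sum u)
  moreover have "0 \<le> \<phi> V y" for V y
    unfolding \<phi>_def by (intro sum_nonneg u)
  moreover have "y \<in> V" if "0 < \<phi> V y" for V y
  proof (rule ccontr)
    assume "y \<notin> V"
    then have "u x y = 0" if "W x = V" for x
      using u(2,4)[of x y] that by force
    then have "\<phi> V y = 0" unfolding \<phi>_def by (intro sum.neutral) simp
    then show False using that by simp
  qed
  moreover have "\<exists>V\<in>\<V>. 0 < \<phi> V y" for y
  proof -
    have "y \<in> (\<Union>x\<in>Y. {y. 0 < u x y})" by (rule subsetD[OF Y(2) UNIV_I])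
    then obtain x where x: "x \<in> Y" "0 < u x y" by blast
    have "u x y \<le> \<phi> (W x) y"
      unfolding \<phi>_def using x(1) by (intro member_le_sum fin u(2)) simp
    then have "0 < \<phi> (W x) y" using x(2) by simp
    then show ?thesis using W(1)[of x] by blast
  qed
  ultimately show ?thesis by (intro exI[of _ \<phi>] conjI allI impI) simp_all
qed

text \<open>The analogue of \<open>colored_refinement\<close> in which b stands for its positivity
  set. Functions, unlike open sets of K, can be added to a countable algebra, and then the
  refinement descends to M. The colors are 0 to n, one more than the dimension.\<close>

definition colored_functions :: "nat \<Rightarrow> ('a::topological_space \<Rightarrow> real) set \<Rightarrow> (nat \<Rightarrow> ('a \<Rightarrow> real) set) \<Rightarrow> bool" where
  "colored_functions n F B \<longleftrightarrow>
    (\<forall>c. finite (B c)) \<and>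
    (\<forall>c. \<forall>b\<in>B c. continuous_on UNIV b \<and> (\<exists>f\<in>F. \<forall>y. 0 < b y \<longrightarrow> 0 < f y)) \<and>
    (\<forall>c. \<forall>b\<in>B c. \<forall>b'\<in>B c. \<forall>y. 0 < b y \<longrightarrow> 0 < b' y \<longrightarrow> b = b') \<and>
    (\<forall>y. \<exists>c\<le>n. \<exists>b\<in>B c. 0 < b y)"

text \<open>Covering dimension bounds how many sets meet at a point; subdividing the nerve turns
  this into a bound on colors. A set T gets the color \<open>card T - 1\<close>. Two different sets
  of one size cannot both dominate at y, as each contains an index that the other lacks.\<close>

lemma colored_functions_exist:
  fixes F :: "('a::t1_space \<Rightarrow> real) set"
  assumes normal: "normal_space (euclidean :: 'a topology)" and comp: "compact (UNIV :: 'a set)"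
    and dim: "covering_dim_le (euclidean :: 'a topology) n"
    and F: "finite F" "\<And>f. f \<in> F \<Longrightarrow> continuous_on UNIV f" "\<And>y. \<exists>f\<in>F. 0 < f y"
  shows "\<exists>B. colored_functions n F B"
proof -
  define \<U> where "\<U> = (\<lambda>f. {y. 0 < f y}) ` F"
  have "finite \<U> \<and> (\<forall>U\<in>\<U>. openin euclidean U) \<and> \<Union>\<U> = topspace euclidean"
    using F unfolding \<U>_def by (auto intro!: open_Collect_less continuous_on_const)
  then obtain \<V> where \<V>: "finite \<V>" "\<forall>V\<in>\<V>. open V" "\<Union>\<V> = (UNIV :: 'a set)"
      "\<forall>V\<in>\<V>. \<exists>U\<in>\<U>. V \<subseteq> U" "\<forall>x. card {V\<in>\<V>. x \<in> V} \<le> n + 1"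
    using dim[unfolded covering_dim_le_def, THEN spec[of _ \<U>]] by auto
  obtain \<phi> where \<phi>0: "(\<forall>V. continuous_on UNIV (\<phi> V) \<and> (\<forall>y. 0 \<le> \<phi> V y) \<and> (\<forall>y. 0 < \<phi> V y \<longrightarrow> y \<in> V)) \<and>
    (\<forall>y. \<exists>V\<in>\<V>. (0::real) < \<phi> V y)"
    using partition_functions[OF normal comp \<V>(1) bspec[OF \<V>(2)] \<V>(3)] by (rule exE)
  have \<phi>: "continuous_on UNIV (\<phi> V)" "0 \<le> \<phi> V y" "0 < \<phi> V y \<Longrightarrow> y \<in> V" for V y
    using \<phi>0 by simp_all
  have \<phi>_pos: "\<exists>V\<in>\<V>. 0 < \<phi> V y" for y using \<phi>0 by simp
  \<comment> \<open>As in a barycentric subdivision: \<open>b T\<close> is positive where the functions of \<open>T\<close> exceed all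
    others, so that the positivity sets for different \<open>T\<close> of the same size are disjoint.\<close>
  define b where "b T y = (\<Prod>V\<in>T. \<phi> V y) * (\<Prod>V\<in>T. \<Prod>W\<in>\<V> - T. max 0 (\<phi> V y - \<phi> W y))" for T y
  have b_pos: "0 < b T y \<longleftrightarrow> (\<forall>V\<in>T. 0 < \<phi> V y \<and> (\<forall>W\<in>\<V> - T. \<phi> W y < \<phi> V y))" if T: "T \<subseteq> \<V>" for T y
  proof
    have fin: "finite T" "finite (\<V> - T)" using T \<V>(1) finite_subset by auto
    assume pos: "0 < b T y"
    show "\<forall>V\<in>T. 0 < \<phi> V y \<and> (\<forall>W\<in>\<V> - T. \<phi> W y < \<phi> V y)"
    proof (intro ballI conjI)
      fix V assume V: "V \<in> T"
      have "(\<Prod>V\<in>T. \<phi> V y) \<noteq> 0" using pos unfolding b_def by auto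
      then have "\<phi> V y \<noteq> 0" using fin(1) V by (simp add: prod_zero_iff)
      then show "0 < \<phi> V y" using \<phi>(2)[of V y] by simp
      fix W assume W: "W \<in> \<V> - T"
      have "(\<Prod>V\<in>T. \<Prod>W\<in>\<V> - T. max 0 (\<phi> V y - \<phi> W y)) \<noteq> 0" using pos unfolding b_def by auto
      then have "(\<Prod>W\<in>\<V> - T. max 0 (\<phi> V y - \<phi> W y)) \<noteq> 0" using fin(1) V by (simp add: prod_zero_iff)
      then have "max 0 (\<phi> V y - \<phi> W y) \<noteq> 0" using fin(2) W by (simp add: prod_zero_iff)
      then show "\<phi> W y < \<phi> V y" by (simp add: max_def split: if_splits)
    qed
  next
    assume *: "\<forall>V\<in>T. 0 < \<phi> V y \<and> (\<forall>W\<in>\<V> - T. \<phi> W y < \<phi> V y)"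
    show "0 < b T y"
      unfolding b_def
    proof (rule mult_pos_pos)
      show "0 < (\<Prod>V\<in>T. \<phi> V y)" by (rule prod_pos) (use * in blast)
      show "0 < (\<Prod>V\<in>T. \<Prod>W\<in>\<V> - T. max 0 (\<phi> V y - \<phi> W y))"
      proof (rule prod_pos, rule prod_pos)
        fix V W assume "V \<in> T" "W \<in> \<V> - T"
        then have "\<phi> W y < \<phi> V y" using * by blast
        then show "0 < max 0 (\<phi> V y - \<phi> W y)" by simp
      qed
    qed
  qed
  define B where "B c = b ` {T. T \<subseteq> \<V> \<and> card T = Suc c}" for c
  have cont: "continuous_on UNIV (b T)" for T
    unfolding b_def by (intro continuous_intros \<phi>)
  show ?thesis
  proof (rule exI[of _ B], unfold colored_functions_def, intro conjI allI ballI impI)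
    show "finite (B c)" for c
      unfolding B_def by (rule finite_imageI, rule finite_subset[of _ "Pow \<V>"]) (use \<V>(1) in auto)
    show "continuous_on UNIV f" if "f \<in> B c" for c f
      using that cont unfolding B_def by blast
    show "\<exists>f\<in>F. \<forall>y. 0 < g y \<longrightarrow> 0 < f y" if g: "g \<in> B c" for c g
    proof -
      from g obtain T where T: "T \<subseteq> \<V>" "card T = Suc c" "g = b T" unfolding B_def by blast
      then have "T \<noteq> {}" by auto
      then obtain V where V: "V \<in> T" by blast
      then obtain U where U: "U \<in> \<U>" "V \<subseteq> U" using \<V>(4) T(1) by blast
      then obtain f where f: "f \<in> F" "U = {y. 0 < f y}" unfolding \<U>_def by blast
      have "0 < f y" if "0 < g y" for y
        using that b_pos[OF T(1)] V \<phi>(3) U(2) f(2) unfolding T(3) by blast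
      then show ?thesis using f(1) by blast
    qed
    show "g = g'" if g: "g \<in> B c" "g' \<in> B c" and pos: "0 < g y" "0 < g' y" for c g g' y
    proof -
      from g(1) obtain T where T: "T \<subseteq> \<V>" "card T = Suc c" "g = b T" unfolding B_def by blast
      from g(2) obtain T' where T': "T' \<subseteq> \<V>" "card T' = Suc c" "g' = b T'" unfolding B_def by blast
      have fin: "finite T" "finite T'" using T(1) T'(1) \<V>(1) finite_subset by auto
      have "T = T'"
      proof (rule ccontr)
        assume ne: "T \<noteq> T'"
        have "\<not> T \<subseteq> T'" using card_subset_eq[OF fin(2), of T] T(2) T'(2) ne by auto
        then obtain V where V: "V \<in> T" "V \<notin> T'" by blast
        have "\<not> T' \<subseteq> T" using card_subset_eq[OF fin(1), of T'] T(2) T'(2) ne by auto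
        then obtain V' where V': "V' \<in> T'" "V' \<notin> T" by blast
        have "\<phi> V' y < \<phi> V y" using b_pos[OF T(1), of y] pos(1) V V' T'(1) unfolding T(3) by blast
        moreover have "\<phi> V y < \<phi> V' y" using b_pos[OF T'(1), of y] pos(2) V V' T(1) unfolding T'(3) by blast
        ultimately show False by simp
      qed
      then show ?thesis using T(3) T'(3) by simp
    qed
    show "\<exists>c\<le>n. \<exists>g\<in>B c. 0 < g y" for y
    proof -
      \<comment> \<open>The indices with the largest value at y dominate all others. Their members
        of the cover contain y, hence there are at most n + 1 of them.\<close>
      define M where "M = Max ((\<lambda>V. \<phi> V y) ` \<V>)"
      define T where "T = {V\<in>\<V>. \<phi> V y = M}"
      have ne: "\<V> \<noteq> {}" using \<V>(3) by auto
      have le: "\<phi> V y \<le> M" if "V \<in> \<V>" for V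
        unfolding M_def using that \<V>(1) by simp
      have "M \<in> (\<lambda>V. \<phi> V y) ` \<V>" unfolding M_def using ne \<V>(1) by (intro Max_in) auto
      then have Tne: "T \<noteq> {}" unfolding T_def by auto
      have "0 < M" using \<phi>_pos[of y] le by (meson less_le_trans)
      have T: "T \<subseteq> \<V>" unfolding T_def by blast
      have "0 < \<phi> V y \<and> (\<forall>W\<in>\<V> - T. \<phi> W y < \<phi> V y)" if "V \<in> T" for V
        using that \<open>0 < M\<close> le unfolding T_def by (auto simp: order_less_le)
      then have "0 < b T y" using b_pos[OF T] by blast
      have "T \<subseteq> {V\<in>\<V>. y \<in> V}"
        unfolding T_def using \<open>0 < M\<close> \<phi>(3) by auto
      then have "card T \<le> card {V\<in>\<V>. y \<in> V}" using \<V>(1) by (intro card_mono) auto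
      then have "card T \<le> n + 1" using \<V>(5) le_trans by blast
      moreover have "card T \<noteq> 0" using Tne T \<V>(1) finite_subset by fastforce
      ultimately have "card T - 1 \<le> n" "card T = Suc (card T - 1)" by auto
      moreover from this have "b T \<in> B (card T - 1)" unfolding B_def using T by blast
      ultimately show ?thesis using \<open>0 < b T y\<close> by (intro exI[of _ "card T - 1"] conjI bexI[of _ "b T"])
    qed
  qed
qed

section \<open>Countable function algebras and the quotients they define\<close>

text \<open>Only rational constants are asked for, so that such a set can be countable;
  \<open>max\<close> makes truncation possible.\<close>

definition rational_lattice_algebra :: "('a \<Rightarrow> real) set \<Rightarrow> bool" where
  "rational_lattice_algebra \<A> \<longleftrightarrow>
    (\<forall>r\<in>\<rat>. (\<lambda>_. r) \<in> \<A>) \<and>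
    (\<forall>f\<in>\<A>. \<forall>g\<in>\<A>. (\<lambda>y. f y + g y) \<in> \<A> \<and> (\<lambda>y. f y * g y) \<in> \<A> \<and> (\<lambda>y. max (f y) (g y)) \<in> \<A>)"

lemma rational_lattice_algebraD:
  assumes "rational_lattice_algebra \<A>"
  shows "r \<in> \<rat> \<Longrightarrow> (\<lambda>_. r) \<in> \<A>"
    and "f \<in> \<A> \<Longrightarrow> g \<in> \<A> \<Longrightarrow> (\<lambda>y. f y + g y) \<in> \<A>"
    and "f \<in> \<A> \<Longrightarrow> g \<in> \<A> \<Longrightarrow> (\<lambda>y. f y * g y) \<in> \<A>"
    and "f \<in> \<A> \<Longrightarrow> g \<in> \<A> \<Longrightarrow> (\<lambda>y. max (f y) (g y)) \<in> \<A>"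
  using assms unfolding rational_lattice_algebra_def by simp_all

lemma rational_lattice_algebra_uminus:
  assumes "rational_lattice_algebra \<A>" "f \<in> \<A>"
  shows "(\<lambda>y. - f y) \<in> \<A>"
  using rational_lattice_algebraD(3)[OF assms(1) rational_lattice_algebraD(1)[OF assms(1), of "-1"] assms(2)] by simp

lemma rational_lattice_algebra_diff:
  assumes "rational_lattice_algebra \<A>" "f \<in> \<A>" "g \<in> \<A>"
  shows "(\<lambda>y. f y - g y) \<in> \<A>"
  using rational_lattice_algebraD(2)[OF assms(1,2) rational_lattice_algebra_uminus[OF assms(1,3)]] by simp

lemma rational_lattice_algebra_min:
  assumes "rational_lattice_algebra \<A>" "f \<in> \<A>" "g \<in> \<A>"
  shows "(\<lambda>y. min (f y) (g y)) \<in> \<A>"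
proof -
  have "(\<lambda>y. - max (- f y) (- g y)) \<in> \<A>"
    using assms by (intro rational_lattice_algebra_uminus rational_lattice_algebraD(4))
  moreover have "- max (- f y) (- g y) = min (f y) (g y)" for y by (simp add: min_def max_def)
  ultimately show ?thesis by simp
qed

lemma rational_lattice_algebra_prod:
  assumes "rational_lattice_algebra \<A>" "finite X" "\<And>x. x \<in> X \<Longrightarrow> f x \<in> \<A>"
  shows "(\<lambda>y. \<Prod>x\<in>X. f x y) \<in> \<A>"
  using assms(2,3)
proof (induction X rule: finite_induct)
  case empty
  show ?case using rational_lattice_algebraD(1)[OF assms(1), of 1] by simp
next
  case (insert x X)
  then have "(\<lambda>y. f x y * (\<Prod>x\<in>X. f x y)) \<in> \<A>"
    by (intro rational_lattice_algebraD(3)[OF assms(1)]) simp_all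
  then show ?case using insert.hyps by simp
qed

text \<open>A rational threshold s between the two values and an integer slope k keep the truncated
  affine image of f inside the algebra.\<close>

lemma rational_lattice_algebra_step:
  assumes \<A>: "rational_lattice_algebra \<A>" and f: "f \<in> \<A>" "f r < f p"
  shows "\<exists>h\<in>\<A>. (\<forall>y. 0 \<le> h y \<and> h y \<le> 1) \<and> h p = 1 \<and> h r = 0"
proof -
  obtain s where s: "s \<in> \<rat>" "f r < s" "s < f p" using Rats_dense_in_real[OF f(2)] by blast
  obtain k :: nat where k: "1 < real k * (f p - s)" using ex_less_of_nat_mult[of "f p - s" 1] s(3) by auto
  define h where "h y = max 0 (min 1 (real k * (f y - s)))" for y
  have "(\<lambda>y. max 0 (min 1 (real k * (f y - s)))) \<in> \<A>"
    by (intro rational_lattice_algebraD[OF \<A>] rational_lattice_algebra_min[OF \<A>] rational_lattice_algebra_diff[OF \<A>] f s) auto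
  then have "h \<in> \<A>" unfolding h_def .
  moreover have "real k * (f r - s) \<le> 0" using s(2) by (simp add: mult_nonneg_nonpos)
  then have "h r = 0" by (simp add: h_def)
  moreover have "h p = 1" using k by (simp add: h_def)
  moreover have "0 \<le> h y \<and> h y \<le> 1" for y by (simp add: h_def)
  ultimately show ?thesis by (intro bexI[of _ h] conjI allI) simp_all
qed

lemma rational_lattice_algebra_separate:
  assumes \<A>: "rational_lattice_algebra \<A>" and f: "f \<in> \<A>" "f p \<noteq> f r"
  shows "\<exists>h\<in>\<A>. (\<forall>y. 0 \<le> h y \<and> h y \<le> 1) \<and> h p = 1 \<and> h r = 0"
proof (cases "f r < f p")
  case True
  then show ?thesis using rational_lattice_algebra_step[OF \<A> f(1)] by simp
next
  case False
  then have "f p < f r" using f(2) by simp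
  then obtain h where h: "h \<in> \<A>" "\<forall>y. 0 \<le> h y \<and> h y \<le> 1" "h r = 1" "h p = 0"
    using rational_lattice_algebra_step[OF \<A> f(1), of p r] by blast
  have "(\<lambda>y. 1 - h y) \<in> \<A>"
    by (intro rational_lattice_algebra_diff[OF \<A>] rational_lattice_algebraD(1)[OF \<A>] h(1)) simp
  then show ?thesis using h by (intro bexI[of _ "\<lambda>y. 1 - h y"]) simp_all
qed

text \<open>Products preserve the value 1 at p and collect zeros over R. The dual operation
  \<open>1 - (1 - h) * (1 - g)\<close> preserves these zeros and collects ones over P.\<close>

lemma rational_lattice_algebra_separate_finite:
  assumes \<A>: "rational_lattice_algebra \<A>" and "finite P" "finite R"
    and sep: "\<And>p r. p \<in> P \<Longrightarrow> r \<in> R \<Longrightarrow> \<exists>f\<in>\<A>. f p \<noteq> f r"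
  shows "\<exists>h\<in>\<A>. (\<forall>y. 0 \<le> h y \<and> h y \<le> 1) \<and> (\<forall>p\<in>P. h p = 1) \<and> (\<forall>r\<in>R. h r = 0)"
proof -
  have one: "\<exists>h\<in>\<A>. (\<forall>y. 0 \<le> h y \<and> h y \<le> 1) \<and> h p = 1 \<and> (\<forall>r\<in>R. h r = 0)" if p: "p \<in> P" for p
    using \<open>finite R\<close> sep[OF p]
  proof (induction R rule: finite_induct)
    case empty
    show ?case using rational_lattice_algebraD(1)[OF \<A>, of 1] by (intro bexI[of _ "\<lambda>_. 1"]) simp_all
  next
    case (insert r R)
    obtain h where h: "h \<in> \<A>" "\<forall>y. 0 \<le> h y \<and> h y \<le> 1" "h p = 1" "\<forall>r\<in>R. h r = 0"
      using insert.IH insert.prems by blast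
    obtain f where f: "f \<in> \<A>" "f p \<noteq> f r" using insert.prems[of r] by blast
    obtain g where g: "g \<in> \<A>" "\<forall>y. 0 \<le> g y \<and> g y \<le> 1" "g p = 1" "g r = 0"
      using rational_lattice_algebra_separate[OF \<A> f] by blast
    have "(\<lambda>y. h y * g y) \<in> \<A>" by (rule rational_lattice_algebraD(3)[OF \<A> h(1) g(1)])
    then show ?case
      using h g by (intro bexI[of _ "\<lambda>y. h y * g y"]) (simp_all add: mult_le_one)
  qed
  show ?thesis
    using \<open>finite P\<close> one
  proof (induction P rule: finite_induct)
    case empty
    show ?case using rational_lattice_algebraD(1)[OF \<A>, of 0] by (intro bexI[of _ "\<lambda>_. 0"]) simp_all
  next
    case (insert p P)
    obtain h where h: "h \<in> \<A>" "\<forall>y. 0 \<le> h y \<and> h y \<le> 1" "\<forall>p\<in>P. h p = 1" "\<forall>r\<in>R. h r = 0"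
      using insert.IH insert.prems by blast
    obtain g where g: "g \<in> \<A>" "\<forall>y. 0 \<le> g y \<and> g y \<le> 1" "g p = 1" "\<forall>r\<in>R. g r = 0"
      using insert.prems[of p] by blast
    have "(\<lambda>y. 1 - (1 - h y) * (1 - g y)) \<in> \<A>"
      by (intro rational_lattice_algebra_diff[OF \<A>] rational_lattice_algebraD(1,3)[OF \<A>] h(1) g(1)) simp_all
    then show ?case
      using h g by (intro bexI[of _ "\<lambda>y. 1 - (1 - h y) * (1 - g y)"]) (simp_all add: mult_le_one)
  qed
qed

text \<open>A Loewenheim-Skolem argument: \<open>R F\<close> is what the finite set F generates, and
  a finite subset of the union of the increasing chain \<open>C k\<close> already lies in one of its
  members.\<close>

lemma countable_closed_set:
  fixes R :: "'b set \<Rightarrow> 'b set"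
  assumes "\<And>F. finite F \<Longrightarrow> countable (R F)"
  obtains A where "countable A" "\<And>F. finite F \<Longrightarrow> F \<subseteq> A \<Longrightarrow> R F \<subseteq> A"
proof -
  define C where "C k = ((\<lambda>A. A \<union> (\<Union>F\<in>{F. finite F \<and> F \<subseteq> A}. R F)) ^^ k) {}" for k
  have C_Suc: "C (Suc k) = C k \<union> (\<Union>F\<in>{F. finite F \<and> F \<subseteq> C k}. R F)" for k
    by (simp add: C_def)
  have countC: "countable (C k)" for k
  proof (induction k)
    case 0
    show ?case by (simp add: C_def)
  next
    case (Suc k)
    then show ?case
      unfolding C_Suc using assms by (intro countable_Un countable_UN countable_Collect_finite_subset) auto
  qed
  have mono: "C j \<subseteq> C k" if "j \<le> k" for j k
    using that by (rule lift_Suc_mono_le[of C, rotated]) (use C_Suc in blast)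
  show ?thesis
  proof (rule that[of "\<Union>k. C k"])
    show "countable (\<Union>k. C k)" using countC by (intro countable_UN) auto
    show "R F \<subseteq> (\<Union>k. C k)" if F: "finite F" "F \<subseteq> (\<Union>k. C k)" for F
    proof -
      have "\<exists>k. F \<subseteq> C k"
        using F
      proof (induction F rule: finite_induct)
        case (insert x F)
        then obtain k where k: "F \<subseteq> C k" by blast
        obtain j where j: "x \<in> C j" using insert.prems by blast
        have "insert x F \<subseteq> C (max k j)" using k j mono[of k "max k j"] mono[of j "max k j"] by auto
        then show ?case by blast
      qed simp
      then obtain k where "F \<subseteq> C k" by blast
      then have "R F \<subseteq> C (Suc k)" unfolding C_Suc using F(1) by blast
      then show ?thesis by blast
    qed
  qed
qed

text \<open>A continuous image of a finite-dimensional compact space can have larger dimension;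
  closing the algebra under \<open>colored_functions\<close> prevents this. As e enumerates the
  algebra, each member is a coordinate on the image, so its positivity set comes from an open set
  there. Colored refinements found on the domain therefore live on the image.\<close>

lemma colored_refinable_range:
  fixes e :: "nat \<Rightarrow> 'a::topological_space \<Rightarrow> real"
  assumes comp: "compact (UNIV :: 'a set)" and cont: "\<And>k. continuous_on UNIV (e k)"
    and \<A>: "rational_lattice_algebra (range e)"
    and colored: "\<And>F. finite F \<Longrightarrow> F \<subseteq> range e \<Longrightarrow> (\<And>y. \<exists>f\<in>F. 0 < f y) \<Longrightarrow>
      \<exists>B. colored_functions n F B \<and> (\<forall>c\<le>n. B c \<subseteq> range e)"
  shows "colored_refinable (Suc n) (range (\<lambda>y k. e k y))"
proof (rule colored_refinableI)
  define q where "q y = (\<lambda>k. e k y)" for y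
  have q_cont: "continuous_on UNIV q"
    unfolding q_def by (rule continuous_on_coordinatewise_then_product) (rule cont)
  \<comment> \<open>Positivity sets of members of the algebra form a base for the preimages of open
    sets under q.\<close>
  have bump: "\<exists>f\<in>range e. 0 < f y \<and> (\<forall>x. 0 < f x \<longrightarrow> q x \<in> G)" if G: "open G" "q y \<in> G" for G y
  proof -
    define C where "C = {x. q x \<notin> G}"
    have "C = - (q -` G)" unfolding C_def by blast
    then have "closed C" using open_vimage[OF G(1) q_cont] by (simp add: closed_Compl)
    then have "compact C" using comp compact_Int_closed[of UNIV C] by simp
    have "\<exists>h. h \<in> range e \<and> h y = 1 \<and> h x = 0" if "x \<in> C" for x
    proof -
      have "q x \<notin> G" using that unfolding C_def by simp
      then have "q y \<noteq> q x" using G(2) by auto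
      then obtain k where k: "e k y \<noteq> e k x" unfolding q_def by (auto simp: fun_eq_iff)
      have "e k \<in> range e" by (rule rangeI)
      from rational_lattice_algebra_separate[OF \<A> this k] show ?thesis
        by (elim bexE conjE) (intro exI conjI)
    qed
    then have "\<forall>x. \<exists>h. x \<in> C \<longrightarrow> h \<in> range e \<and> h y = 1 \<and> h x = 0" by blast
    then obtain h where "\<forall>x. x \<in> C \<longrightarrow> h x \<in> range e \<and> h x y = 1 \<and> h x x = 0"
      by (rule choice[THEN exE])
    then have h: "h x \<in> range e" "h x y = 1" "h x x = 0" if "x \<in> C" for x using that by simp_all
    have h_cont: "continuous_on UNIV (h x)" if "x \<in> C" for x
      using h(1)[OF that] cont by (elim rangeE) simp
    have "open {z. h x z < 1/2}" if "x \<in> C" for x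
      by (intro open_Collect_less continuous_on_const h_cont that)
    moreover have "C \<subseteq> (\<Union>x\<in>C. {z. h x z < 1/2})"
    proof
      fix x assume "x \<in> C"
      then show "x \<in> (\<Union>x\<in>C. {z. h x z < 1/2})" using h(3) by (intro UN_I[of x]) simp_all
    qed
    ultimately obtain X where X: "X \<subseteq> C" "finite X" "C \<subseteq> (\<Union>x\<in>X. {z. h x z < 1/2})"
      using compactE_image[OF \<open>compact C\<close>, of C "\<lambda>x. {z. h x z < 1/2}"] by metis
    \<comment> \<open>The factor for x equals 1/2 at y and vanishes where \<open>h x\<close> is
      below 1/2; the finitely many sets where this happens cover C.\<close>
    define f where "f = (\<lambda>z. \<Prod>x\<in>X. max 0 (h x z - 1/2))"
    have "f \<in> range e"
      unfolding f_def
    proof (rule rational_lattice_algebra_prod[OF \<A> X(2)])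
      fix x assume "x \<in> X"
      then have "h x \<in> range e" using X(1) h(1) by blast
      then show "(\<lambda>z. max 0 (h x z - 1/2)) \<in> range e"
        by (intro rational_lattice_algebraD[OF \<A>] rational_lattice_algebra_diff[OF \<A>]) auto
    qed
    moreover have "0 < f y"
      unfolding f_def
    proof (rule prod_pos)
      fix x assume "x \<in> X"
      then have "h x y = 1" using X(1) h(2) by blast
      then show "0 < max 0 (h x y - 1/2)" by simp
    qed
    moreover have "q z \<in> G" if "0 < f z" for z
    proof (rule ccontr)
      assume "q z \<notin> G"
      then have "z \<in> (\<Union>x\<in>X. {z. h x z < 1/2})" using X(3) unfolding C_def by blast
      then obtain x where x: "x \<in> X" "h x z < 1/2" by blast
      then have "max 0 (h x z - 1/2) = 0" by simp
      then have "f z = 0" unfolding f_def using x(1) X(2) by (intro prod_zero) auto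
      then show False using that by simp
    qed
    ultimately show ?thesis by (intro bexI[of _ f] conjI allI impI)
  qed
  fix \<G> :: "(nat \<Rightarrow> real) set set"
  assume \<G>: "\<forall>G\<in>\<G>. open G" "range (\<lambda>y k. e k y) \<subseteq> \<Union>\<G>"
  have "\<exists>G. G \<in> \<G> \<and> q y \<in> G" for y
    using \<G>(2) unfolding q_def by blast
  then have "\<forall>y. \<exists>f. f \<in> range e \<and> 0 < f y \<and> (\<exists>G\<in>\<G>. \<forall>x. 0 < f x \<longrightarrow> q x \<in> G)"
    using bump \<G>(1) by meson
  then obtain f where "\<forall>y. f y \<in> range e \<and> 0 < f y y \<and> (\<exists>G\<in>\<G>. \<forall>x. 0 < f y x \<longrightarrow> q x \<in> G)"
    by (rule choice[THEN exE])
  then have f: "f y \<in> range e" "0 < f y y" "\<exists>G\<in>\<G>. \<forall>x. 0 < f y x \<longrightarrow> q x \<in> G" for y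
    by simp_all
  have "continuous_on UNIV (f y)" for y using f(1)[of y] cont by (elim rangeE) simp
  then have "open {x. 0 < f y x}" for y by (intro open_Collect_less continuous_on_const)
  moreover have "UNIV \<subseteq> (\<Union>y. {x. 0 < f y x})" using f(2) by (intro subsetI UN_I) auto
  ultimately obtain Y where Y: "finite Y" "UNIV \<subseteq> (\<Union>y\<in>Y. {x. 0 < f y x})"
    using compactE_image[OF comp, of UNIV "\<lambda>y. {x. 0 < f y x}"] by metis
  have pos: "\<exists>g\<in>f ` Y. 0 < g x" for x
    using subsetD[OF Y(2), of x] by auto
  have "f ` Y \<subseteq> range e" using f(1) by blast
  then obtain B where "colored_functions n (f ` Y) B" and Be: "\<And>c. c \<le> n \<Longrightarrow> B c \<subseteq> range e"
    using colored[OF finite_imageI[OF Y(1)] _ pos] by blast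
  then have B: "b \<in> B c \<Longrightarrow> \<exists>g\<in>f ` Y. \<forall>y. 0 < b y \<longrightarrow> 0 < g y"
      "b \<in> B c \<Longrightarrow> b' \<in> B c \<Longrightarrow> 0 < b y \<Longrightarrow> 0 < b' y \<Longrightarrow> b = b'"
      "\<exists>c\<le>n. \<exists>b\<in>B c. 0 < b y" for b b' c y
    unfolding colored_functions_def by simp_all
  define idx where "idx b = (SOME k. e k = b)" for b
  have idx: "e (idx b) = b" if "b \<in> range e" for b
    unfolding idx_def using that by (intro someI_ex[of "\<lambda>k. e k = b"]) blast
  define U where "U b = {w::nat \<Rightarrow> real. 0 < w (idx b)}" for b
  have mem_U: "q y \<in> U b \<longleftrightarrow> 0 < b y" if "b \<in> range e" for b y
    unfolding U_def q_def using idx[OF that] by simp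
  have "colored_refinement (Suc n) (range q) \<G> (\<lambda>c. U ` B c)"
  proof (rule colored_refinementI)
    fix c V assume c: "c < Suc n" and "V \<in> U ` B c"
    then obtain b where b: "b \<in> B c" "V = U b" by blast
    have be: "b \<in> range e" using Be[of c] c b(1) by auto
    show "open V" unfolding b(2) U_def
      by (intro open_Collect_less continuous_on_const continuous_on_product_coordinates)
    obtain y where y: "\<forall>x. 0 < b x \<longrightarrow> 0 < f y x" using B(1)[OF b(1)] by blast
    obtain G where G: "G \<in> \<G>" "\<forall>x. 0 < f y x \<longrightarrow> q x \<in> G" using f(3)[of y] by blast
    have "w \<in> G" if w: "w \<in> range q" "w \<in> V" for w
    proof -
      from w(1) obtain x where x: "w = q x" by blast
      then have "0 < b x" using w(2) mem_U[OF be] b(2) by simp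
      then show ?thesis using y G(2) x by simp
    qed
    then have "range q \<inter> V \<subseteq> G" by blast
    then show "\<exists>G\<in>\<G>. range q \<inter> V \<subseteq> G" using G(1) by (rule_tac bexI)
  next
    fix c V W w assume c: "c < Suc n" and V: "V \<in> U ` B c" and W: "W \<in> U ` B c"
      and w: "w \<in> range q" "w \<in> V" "w \<in> W"
    obtain b where b: "b \<in> B c" "V = U b" using V by blast
    obtain b' where b': "b' \<in> B c" "W = U b'" using W by blast
    obtain x where x: "w = q x" using w(1) by blast
    have be: "b \<in> range e" "b' \<in> range e" using Be[of c] c b(1) b'(1) by auto
    have "b = b'"
      using B(2)[OF b(1) b'(1), of x] w(2,3) mem_U[OF be(1)] mem_U[OF be(2)] b(2) b'(2) x by simp
    then show "V = W" using b b' by simp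
  next
    fix w assume "w \<in> range q"
    then obtain x where x: "w = q x" by blast
    obtain c b where c: "c \<le> n" "b \<in> B c" "0 < b x" using B(3)[of x] by blast
    have be: "b \<in> range e" using Be[of c] c by auto
    have "w \<in> U b" using mem_U[OF be] c(3) x by simp
    then show "\<exists>c<Suc n. \<exists>V\<in>U ` B c. w \<in> V"
      using c by (intro exI[of _ c] conjI bexI[of _ "U b"] imageI) simp_all
  qed
  then show "\<exists>\<D>. colored_refinement (Suc n) (range (\<lambda>y k. e k y)) \<G> \<D>"
    unfolding q_def by (rule exI[of _ "\<lambda>c. U ` B c"])
qed

section \<open>Weak and pointwise topology\<close>

lemma openin_weak_topology_vimage:
  fixes \<nu> :: "'a::real_normed_vector \<Rightarrow> real"
  assumes "bounded_linear \<nu>" "open U"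
  shows "openin weak_topology (\<nu> -` U)"
  unfolding weak_topology_def
  by (rule topology_generated_by_Basis) (use assms in blast)

lemma topspace_weak_topology: "topspace (weak_topology :: 'a::real_normed_vector topology) = UNIV"
proof -
  have "openin weak_topology ((\<lambda>_::'a. 0::real) -` UNIV)"
    by (rule openin_weak_topology_vimage) (simp_all add: bounded_linear_zero)
  from openin_subset[OF this] show ?thesis by (simp add: top.extremum_unique)
qed

lemma openin_weak_topology_nhd:
  fixes g :: "'b::real_normed_vector"
  assumes "openin weak_topology U" "g \<in> U"
  shows "\<exists>F d. finite F \<and> (\<forall>\<nu>\<in>F. bounded_linear \<nu>) \<and> 0 < d \<and> (\<forall>h. (\<forall>\<nu>\<in>F. \<bar>\<nu> h - \<nu> g\<bar> < (d::real)) \<longrightarrow> h \<in> U)"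
proof -
  have "generate_topology_on {\<phi> -` U | (\<phi> :: 'b \<Rightarrow> real) U. bounded_linear \<phi> \<and> open U} U"
    using assms(1) unfolding weak_topology_def by (rule openin_topology_generated_by)
  then show ?thesis using assms(2)
  proof (induction rule: generate_topology_on.induct)
    case Empty
    then show ?case by simp
  next
    case (Int A B)
    have "g \<in> A" "g \<in> B" using Int.prems by simp_all
    obtain F d where F: "finite F" "\<forall>\<nu>\<in>F. bounded_linear \<nu>" "0 < d" "\<forall>h. (\<forall>\<nu>\<in>F. \<bar>\<nu> h - \<nu> g\<bar> < (d::real)) \<longrightarrow> h \<in> A"
      using Int.IH(1)[OF \<open>g \<in> A\<close>] by (elim exE conjE)
    obtain F' d' where F': "finite F'" "\<forall>\<nu>\<in>F'. bounded_linear \<nu>" "0 < d'" "\<forall>h. (\<forall>\<nu>\<in>F'. \<bar>\<nu> h - \<nu> g\<bar> < (d'::real)) \<longrightarrow> h \<in> B"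
      using Int.IH(2)[OF \<open>g \<in> B\<close>] by (elim exE conjE)
    have "h \<in> A \<inter> B" if "\<forall>\<nu>\<in>F \<union> F'. \<bar>\<nu> h - \<nu> g\<bar> < min d d'" for h
    proof
      show "h \<in> A" using F(4)[THEN spec[of _ h]] that by simp
      show "h \<in> B" using F'(4)[THEN spec[of _ h]] that by simp
    qed
    then show ?case
      using F(1,2,3) F'(1,2,3) by (intro exI[of _ "F \<union> F'"] exI[of _ "min d d'"] conjI allI impI) auto
  next
    case (UN K)
    then obtain A where A: "A \<in> K" "g \<in> A" by blast
    obtain F d where F: "finite F" "\<forall>\<nu>\<in>F. bounded_linear \<nu>" "0 < d" "\<forall>h. (\<forall>\<nu>\<in>F. \<bar>\<nu> h - \<nu> g\<bar> < (d::real)) \<longrightarrow> h \<in> A"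
      using UN.IH[OF A] by (elim exE conjE)
    have "\<forall>h. (\<forall>\<nu>\<in>F. \<bar>\<nu> h - \<nu> g\<bar> < d) \<longrightarrow> h \<in> \<Union>K"
    proof (intro allI impI)
      fix h assume "\<forall>\<nu>\<in>F. \<bar>\<nu> h - \<nu> g\<bar> < d"
      then have "h \<in> A" using F(4) by simp
      then show "h \<in> \<Union>K" using A(1) by (rule UnionI[rotated])
    qed
    then show ?case using F(1,2,3) by (intro exI[of _ F] exI[of _ d] conjI)
  next
    case (Basis s)
    then have "\<exists>(\<phi> :: 'b \<Rightarrow> real) V. s = \<phi> -` V \<and> bounded_linear \<phi> \<and> open V" by simp
    then obtain \<phi> :: "'b \<Rightarrow> real" and V where \<phi>: "s = \<phi> -` V" "bounded_linear \<phi>" "open V"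
      by (elim exE conjE)
    have gV: "\<phi> g \<in> V" using Basis.prems \<phi>(1) by simp
    obtain d where d: "0 < d" "\<forall>y. dist y (\<phi> g) < d \<longrightarrow> y \<in> V"
      using bspec[OF \<phi>(3)[unfolded open_dist] gV] by (elim exE conjE)
    have "\<forall>h. (\<forall>\<nu>\<in>{\<phi>}. \<bar>\<nu> h - \<nu> g\<bar> < d) \<longrightarrow> h \<in> s"
      using d(2) \<phi>(1) by (simp add: dist_real_def)
    then show ?case using d(1) \<phi>(2) by (intro exI[of _ "{\<phi>}"] exI[of _ d] conjI) simp_all
  qed
qed

lemma topspace_pointwise_topology: "topspace pointwise_topology = UNIV"
  unfolding pointwise_topology_def topspace_pullback_topology by simp

lemma openin_pointwise_topology_eval:
  assumes "open U"
  shows "openin pointwise_topology {f. apply_bcontfun f y \<in> U}"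
proof -
  have "openin (product_topology (\<lambda>x. euclideanreal) UNIV) {g. g y \<in> U}"
    using openin_continuous_map_preimage[OF continuous_map_product_projection[of y UNIV "\<lambda>_. euclideanreal"], of U] assms
    by simp
  then show ?thesis
    unfolding pointwise_topology_def openin_pullback_topology
    by (intro exI[of _ "{g. g y \<in> U}"]) auto
qed

lemma openin_pointwise_topology_nhd:
  assumes "openin pointwise_topology U" "f \<in> U"
  shows "\<exists>S d. finite S \<and> 0 < d \<and> (\<forall>g. (\<forall>y\<in>S. \<bar>apply_bcontfun g y - apply_bcontfun f y\<bar> < (d::real)) \<longrightarrow> g \<in> U)"
proof -
  obtain V where V: "openin (product_topology (\<lambda>x. euclideanreal) UNIV) V" "U = apply_bcontfun -` V"
    using assms(1) unfolding pointwise_topology_def openin_pullback_topology by auto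
  have "apply_bcontfun f \<in> V" using assms(2) V(2) by simp
  from V(1)[unfolded openin_product_topology_alt, THEN bspec, OF this]
  have "\<exists>T. finite {i. T i \<noteq> UNIV} \<and> (\<forall>i. open (T i)) \<and> apply_bcontfun f \<in> Pi UNIV T \<and> Pi UNIV T \<subseteq> V"
    by (simp add: PiE_UNIV_domain)
  then obtain T where T: "finite {i. T i \<noteq> UNIV}" "\<forall>i. open (T i)" "apply_bcontfun f \<in> Pi UNIV T" "Pi UNIV T \<subseteq> V"
    by (elim exE conjE)
  define S where "S = {i. T i \<noteq> UNIV}"
  have "\<forall>i. \<exists>d>0. \<forall>r. \<bar>r - apply_bcontfun f i\<bar> < d \<longrightarrow> r \<in> T i"
  proof
    fix i
    have "apply_bcontfun f i \<in> T i" using T(3) by (rule Pi_mem) simp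
    with T(2)[THEN spec[of _ i], unfolded open_dist dist_real_def, THEN bspec]
    show "\<exists>d>0. \<forall>r. \<bar>r - apply_bcontfun f i\<bar> < d \<longrightarrow> r \<in> T i" .
  qed
  then obtain d where "\<forall>i. 0 < d i \<and> (\<forall>r. \<bar>r - apply_bcontfun f i\<bar> < d i \<longrightarrow> r \<in> T i)"
    by (rule choice[THEN exE])
  then have d: "0 < d i" "\<bar>r - apply_bcontfun f i\<bar> < d i \<Longrightarrow> r \<in> T i" for i r
    by simp_all
  have fin: "finite S" using T(1) S_def by simp
  define \<delta> where "\<delta> = Min (insert 1 (d ` S))"
  have "0 < \<delta>" unfolding \<delta>_def using fin d(1) by simp
  have \<delta>_le: "\<delta> \<le> d i" if "i \<in> S" for i unfolding \<delta>_def using fin that by simp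
  have "g \<in> U" if g: "\<forall>y\<in>S. \<bar>apply_bcontfun g y - apply_bcontfun f y\<bar> < \<delta>" for g
  proof -
    have "apply_bcontfun g i \<in> T i" for i
    proof (cases "i \<in> S")
      case True
      then have "\<bar>apply_bcontfun g i - apply_bcontfun f i\<bar> < \<delta>" using g by simp
      then have "\<bar>apply_bcontfun g i - apply_bcontfun f i\<bar> < d i" using \<delta>_le[OF True] by simp
      then show ?thesis by (rule d(2))
    next
      case False
      then show ?thesis unfolding S_def by simp
    qed
    then have "apply_bcontfun g \<in> Pi UNIV T" by (intro Pi_I)
    then show ?thesis using T(4) V(2) by blast
  qed
  then show ?thesis using fin \<open>0 < \<delta>\<close> by (intro exI[of _ S] exI[of _ \<delta>] conjI allI impI)
qed

text \<open>A form, relative to the subspace X, of the fact that functionals vanishing on the common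
  kernel of F lie in the span of F. The induction removes \<open>\<nu>\<close> by restricting X to
  its kernel, at the cost of one vector g. Either all \<open>l i\<close> vanish at g, or one index p
  serves as a pivot and is removed too; thus X, I and l must vary.\<close>

lemma functionals_dependent:
  fixes F :: "('b::real_vector \<Rightarrow> real) set" and l :: "'i \<Rightarrow> 'b \<Rightarrow> real"
  assumes "finite F" "\<forall>\<nu>\<in>F. linear \<nu>" "subspace X" "finite I" "card F < card I" "\<forall>i\<in>I. linear (l i)"
    and "\<forall>i\<in>I. \<forall>h\<in>X. (\<forall>\<nu>\<in>F. \<nu> h = 0) \<longrightarrow> l i h = 0"
  shows "\<exists>a. (\<exists>i\<in>I. a i \<noteq> 0) \<and> (\<forall>h\<in>X. (\<Sum>i\<in>I. a i * l i h) = 0)"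
  using assms
proof (induction F arbitrary: X I l rule: finite_induct)
  case empty
  then have "I \<noteq> {}" by auto
  then show ?case using empty.prems by (intro exI[of _ "\<lambda>_. 1"]) auto
next
  case (insert \<nu> F)
  have lin\<nu>: "linear \<nu>" and linF: "\<forall>\<nu>\<in>F. linear \<nu>" using insert.prems(1) by simp_all
  have card: "Suc (card F) < card I" using insert.prems(4) insert.hyps by simp
  have linl: "linear (l i)" if "i \<in> I" for i using insert.prems(5) that by simp
  have van: "l i h = 0" if "i \<in> I" "h \<in> X" "\<nu> h = 0" "\<forall>\<nu>\<in>F. \<nu> h = 0" for i h
    using insert.prems(6) that by simp
  show ?case
  proof (cases "\<forall>h\<in>X. \<nu> h = 0")
    case True
    then show ?thesis
      using card van by (intro insert.IH[OF linF insert.prems(2,3)] insert.prems(5)) simp_all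
  next
    case False
    then obtain g where g: "g \<in> X" "\<nu> g \<noteq> 0" by blast
    define X' where "X' = X \<inter> {h. \<nu> h = 0}"
    have X': "subspace X'"
      unfolding X'_def using insert.prems(2) linear_subspace_kernel[OF lin\<nu>] by (rule subspace_inter)
    \<comment> \<open>The projection onto the kernel of \<open>\<nu>\<close> along g. Functionals
      that vanish at g do not notice it, so relations on the kernel extend to X.\<close>
    define red where "red h = h - (\<nu> h / \<nu> g) *\<^sub>R g" for h
    have red: "red h \<in> X'" if "h \<in> X" for h
    proof -
      have "red h \<in> X"
        unfolding red_def by (intro subspace_diff[OF insert.prems(2)] subspace_scale[OF insert.prems(2)] that g(1))
      moreover have "\<nu> (red h) = 0"
        unfolding red_def using g(2) by (simp add: linear_diff[OF lin\<nu>] linear_scale[OF lin\<nu>])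
      ultimately show ?thesis unfolding X'_def by simp
    qed
    have red_l: "k (red h) = k h" if "linear k" "k g = 0" for k :: "'b \<Rightarrow> real" and h
      unfolding red_def using that by (simp add: linear_diff[OF that(1)] linear_scale[OF that(1)])
    show ?thesis
    proof (cases "\<forall>i\<in>I. l i g = 0")
      case True
      have "\<exists>a. (\<exists>i\<in>I. a i \<noteq> 0) \<and> (\<forall>h\<in>X'. (\<Sum>i\<in>I. a i * l i h) = 0)"
        using card van by (intro insert.IH[OF linF X' insert.prems(3)] insert.prems(5)) (simp_all add: X'_def)
      then obtain a where a: "\<exists>i\<in>I. a i \<noteq> 0" "\<forall>h\<in>X'. (\<Sum>i\<in>I. a i * l i h) = 0" by blast
      have "(\<Sum>i\<in>I. a i * l i h) = 0" if "h \<in> X" for h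
      proof -
        have "(\<Sum>i\<in>I. a i * l i h) = (\<Sum>i\<in>I. a i * l i (red h))"
          by (intro sum.cong refl) (simp add: red_l[OF linl] True)
        then show ?thesis using a(2) red[OF that] by simp
      qed
      then show ?thesis using a(1) by blast
    next
      case False
      then obtain p where p: "p \<in> I" "l p g \<noteq> 0" by blast
      define I' where "I' = I - {p}"
      have I': "finite I'" "card F < card I'"
        unfolding I'_def using insert.prems(3) card p(1) by (simp_all add: card_Diff_singleton)
      define l' where "l' i h = l i h - (l i g / l p g) * l p h" for i h
      have linl': "linear (l' i)" if "i \<in> I'" for i
      proof -
        have "i \<in> I" using that I'_def by simp
        have "linear (\<lambda>h. (l i g / l p g) * l p h)"
          using linear_compose_scale_right[OF linl[OF p(1)], of "l i g / l p g"] by simp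
        then show ?thesis
          unfolding l'_def using linear_compose_sub[OF linl[OF \<open>i \<in> I\<close>]] by blast
      qed
      have van': "l' i h = 0" if "i \<in> I'" "h \<in> X'" "\<forall>\<nu>\<in>F. \<nu> h = 0" for i h
        using that van[of i h] van[of p h] p(1) by (simp add: l'_def X'_def I'_def)
      have "\<exists>a. (\<exists>i\<in>I'. a i \<noteq> 0) \<and> (\<forall>h\<in>X'. (\<Sum>i\<in>I'. a i * l' i h) = 0)"
        using linl' van' by (intro insert.IH[OF linF X' I']) simp_all
      then obtain a where a: "\<exists>i\<in>I'. a i \<noteq> 0" "\<forall>h\<in>X'. (\<Sum>i\<in>I'. a i * l' i h) = 0" by blast
      \<comment> \<open>The coefficient of the pivot collects the corrections contained in all
        \<open>l' i\<close>, which turns the relation between the \<open>l' i\<close> into one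
        between the \<open>l i\<close>.\<close>
      define a' where "a' = a(p := - (\<Sum>i\<in>I'. a i * (l i g / l p g)))"
      have "(\<Sum>i\<in>I. a' i * l i h) = 0" if h: "h \<in> X" for h
      proof -
        have "(\<Sum>i\<in>I. a' i * l i h) = a' p * l p h + (\<Sum>i\<in>I'. a' i * l i h)"
          unfolding I'_def using insert.prems(3) p(1) by (rule sum.remove)
        also have "(\<Sum>i\<in>I'. a' i * l i h) = (\<Sum>i\<in>I'. a i * l i h)"
          by (intro sum.cong refl) (simp add: a'_def I'_def)
        also have "a' p * l p h + (\<Sum>i\<in>I'. a i * l i h) = (\<Sum>i\<in>I'. a i * l' i h)"
          by (simp add: a'_def l'_def right_diff_distrib sum_subtractf sum_distrib_right mult.assoc)
        also have "\<dots> = (\<Sum>i\<in>I'. a i * l' i (red h))"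
        proof (intro sum.cong refl)
          fix i assume "i \<in> I'"
          then show "a i * l' i h = a i * l' i (red h)"
            using red_l[OF linl', of i h] p(2) by (simp add: l'_def)
        qed
        finally show ?thesis using a(2) red[OF h] by simp
      qed
      moreover have "\<exists>i\<in>I. a' i \<noteq> 0" using a(1) unfolding a'_def I'_def by auto
      ultimately show ?thesis by blast
    qed
  qed
qed

section \<open>Measures parametrized by the Hilbert cube\<close>

text \<open>Integration against the measure with mass \<open>t j * (1/2)^j\<close> at
  \<open>x j\<close>. The factor makes the series converge for every bounded t; weights outside the
  cube are allowed, since differences and linear combinations of parameters occur.\<close>

definition weighted_sum :: "(nat \<Rightarrow> 'a) \<Rightarrow> (nat \<Rightarrow> real) \<Rightarrow> ('a::topological_space \<Rightarrow>\<^sub>C real) \<Rightarrow> real" where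
  "weighted_sum x t g = (\<Sum>j. t j * (1/2)^j * apply_bcontfun g (x j))"

lemma weighted_sum_term_bound:
  fixes g :: "'a::topological_space \<Rightarrow>\<^sub>C real"
  assumes "\<And>j. \<bar>t j\<bar> \<le> C"
  shows "\<bar>t j * (1/2)^j * apply_bcontfun g (x j)\<bar> \<le> C * norm g * (1/2)^j"
proof -
  have "0 \<le> C" using assms[of 0] by linarith
  have "\<bar>apply_bcontfun g (x j)\<bar> \<le> norm g" using norm_bounded[of g "x j"] by simp
  then have "\<bar>t j\<bar> * \<bar>apply_bcontfun g (x j)\<bar> \<le> C * norm g"
    using assms[of j] \<open>0 \<le> C\<close> by (intro mult_mono) auto
  then have "\<bar>t j\<bar> * \<bar>apply_bcontfun g (x j)\<bar> * (1/2)^j \<le> C * norm g * (1/2)^j"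
    by (rule mult_right_mono) simp
  then show ?thesis by (simp add: abs_mult mult_ac)
qed

lemma summable_half_powers: "summable (\<lambda>j. K * (1/2::real)^j)"
  by (intro summable_mult summable_geometric) simp

lemma weighted_sum_summable:
  fixes g :: "'a::topological_space \<Rightarrow>\<^sub>C real"
  assumes "\<And>j. \<bar>t j\<bar> \<le> C"
  shows "summable (\<lambda>j. t j * (1/2)^j * apply_bcontfun g (x j))"
  by (rule summable_comparison_test'[OF summable_half_powers, of 0])
    (use weighted_sum_term_bound[OF assms] in simp)

lemma bounded_linear_weighted_sum:
  assumes "\<And>j. \<bar>t j\<bar> \<le> C"
  shows "bounded_linear (weighted_sum x t)"
proof (rule bounded_linear_intro[of _ "C * 2"])
  note summable = weighted_sum_summable[OF assms]
  show "weighted_sum x t (f + g) = weighted_sum x t f + weighted_sum x t g" for f g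
    unfolding weighted_sum_def by (simp add: suminf_add[OF summable summable] distrib_left)
  show "weighted_sum x t (r *\<^sub>R f) = r *\<^sub>R weighted_sum x t f" for r f
    unfolding weighted_sum_def using suminf_mult[OF weighted_sum_summable[OF assms, where g = f and x = x], of r] by (simp add: mult_ac)
  show "norm (weighted_sum x t f) \<le> norm f * (C * 2)" for f
  proof -
    have "norm (weighted_sum x t f) \<le> (\<Sum>j. C * norm f * (1/2)^j)"
      unfolding weighted_sum_def
      by (rule norm_suminf_le[OF _ summable_half_powers]) (use weighted_sum_term_bound[OF assms] in simp)
    also have "\<dots> = C * norm f * (\<Sum>j. (1/2::real)^j)"
      by (intro suminf_mult summable_geometric) simp
    also have "(\<Sum>j. (1/2::real)^j) = 2" by (simp add: suminf_geometric)
    finally show ?thesis by (simp add: mult_ac)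
  qed
qed

lemma weighted_sum_linear_weights:
  assumes "finite L" "\<And>l j. l \<in> L \<Longrightarrow> \<bar>t l j\<bar> \<le> C"
  shows "weighted_sum x (\<lambda>j. \<Sum>l\<in>L. a l * t l j) g = (\<Sum>l\<in>L. a l * weighted_sum x (t l) g)"
proof -
  have "summable (\<lambda>j. t l j * (1/2)^j * apply_bcontfun g (x j))" if "l \<in> L" for l
    using weighted_sum_summable[OF assms(2)[OF that]] .
  then have "(\<Sum>l\<in>L. a l * weighted_sum x (t l) g) = (\<Sum>j. \<Sum>l\<in>L. a l * (t l j * (1/2)^j * apply_bcontfun g (x j)))"
    unfolding weighted_sum_def
    by (subst suminf_sum) (auto intro!: summable_mult sum.cong simp: suminf_mult)
  also have "\<dots> = weighted_sum x (\<lambda>j. \<Sum>l\<in>L. a l * t l j) g"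
    unfolding weighted_sum_def by (simp add: sum_distrib_right mult.assoc)
  finally show ?thesis by simp
qed

lemma hilbert_cube_bound: "t \<in> hilbert_cube \<Longrightarrow> \<bar>t j\<bar> \<le> 1"
  unfolding hilbert_cube_def by (drule Pi_mem[of _ _ _ j]) simp_all

lemma continuous_on_weighted_sum: "continuous_on hilbert_cube (\<lambda>t. weighted_sum x t g)"
proof -
  have "uniform_limit hilbert_cube (\<lambda>n t. \<Sum>j<n. t j * (1/2)^j * apply_bcontfun g (x j))
      (\<lambda>t. weighted_sum x t g) sequentially"
    unfolding weighted_sum_def
  proof (rule Weierstrass_m_test[OF _ summable_half_powers[of "1 * norm g"]])
    fix j t assume "t \<in> hilbert_cube"
    then show "norm (t j * (1/2)^j * apply_bcontfun g (x j)) \<le> 1 * norm g * (1/2)^j"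
      using weighted_sum_term_bound[of t 1 j g x] hilbert_cube_bound by simp
  qed
  moreover have "continuous_on hilbert_cube (\<lambda>t. \<Sum>j<n. t j * (1/2)^j * apply_bcontfun g (x j))" for n
    by (intro continuous_on_sum continuous_on_mult continuous_on_const
        continuous_on_subset[OF continuous_on_product_coordinates]) simp_all
  ultimately show ?thesis
    by (intro uniform_limit_theorem[where F = sequentially]) simp_all
qed

text \<open>If g sees only \<open>x i\<close> among the points with index at most n, the term of
  \<open>x i\<close> is cancelled by the tail. The powers of 1/2 beyond n add up to
  \<open>(1/2)^n\<close>.\<close>

lemma weighted_sum_tail_bound:
  assumes t: "\<And>j. \<bar>t j\<bar> \<le> C" and g: "\<And>y. \<bar>apply_bcontfun g y\<bar> \<le> 1"
    and i: "i \<le> n" "apply_bcontfun g (x i) = 1"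
    and zero: "\<And>j. j \<le> n \<Longrightarrow> j \<noteq> i \<Longrightarrow> apply_bcontfun g (x j) = 0"
    and sum: "weighted_sum x t g = 0"
  shows "\<bar>t i * (1/2)^i\<bar> \<le> C * (1/2)^n"
proof -
  define w where "w j = t j * (1/2)^j * apply_bcontfun g (x j)" for j
  have summable: "summable w" unfolding w_def by (rule weighted_sum_summable[OF t])
  have "(\<Sum>j<Suc n. w j) = (\<Sum>j<Suc n. if j = i then t i * (1/2)^i else 0)"
    by (intro sum.cong refl) (use i(2) zero in \<open>simp add: w_def\<close>)
  also have "\<dots> = t i * (1/2)^i" using i(1) by simp
  finally have "suminf w = (\<Sum>j. w (j + Suc n)) + t i * (1/2)^i"
    using suminf_split_initial_segment[OF summable, of "Suc n"] by simp
  then have "\<bar>t i * (1/2)^i\<bar> = \<bar>\<Sum>j. w (j + Suc n)\<bar>"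
    using sum unfolding weighted_sum_def w_def by simp
  also have "\<dots> \<le> (\<Sum>j. C * (1/2)^Suc n * (1/2)^j)"
  proof -
    have bound: "norm (w (j + Suc n)) \<le> C * (1/2)^Suc n * (1/2)^j" for j
    proof -
      have C: "0 \<le> C" using t[of 0] by linarith
      have "\<bar>t (j + Suc n)\<bar> * \<bar>apply_bcontfun g (x (j + Suc n))\<bar> \<le> C * 1"
        using t g C by (intro mult_mono) auto
      then have "\<bar>t (j + Suc n)\<bar> * \<bar>apply_bcontfun g (x (j + Suc n))\<bar> * (1/2)^(j + Suc n) \<le> C * 1 * (1/2)^(j + Suc n)"
        by (rule mult_right_mono) simp
      then show ?thesis unfolding w_def by (simp add: abs_mult power_add mult_ac)
    qed
    show ?thesis using norm_suminf_le[OF bound summable_half_powers] by simp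
  qed
  also have "\<dots> = C * (1/2)^Suc n * (\<Sum>j. (1/2::real)^j)"
    by (intro suminf_mult summable_geometric) simp
  also have "(\<Sum>j. (1/2::real)^j) = 2" by (simp add: suminf_geometric)
  finally show ?thesis by simp
qed

section \<open>Homeomorphisms preserving a countable set of functions\<close>

lemma openin_pointwise_topology_small:
  assumes "finite S"
  shows "openin pointwise_topology {f. \<forall>y\<in>S. \<bar>apply_bcontfun f y\<bar> < r}"
  using assms
proof (induction S rule: finite_induct)
  case empty
  show ?case using openin_topspace[of pointwise_topology] by (simp add: topspace_pointwise_topology)
next
  case (insert y S)
  have "openin pointwise_topology {f. apply_bcontfun f y \<in> {-r<..<r}}"
    by (rule openin_pointwise_topology_eval) simp
  then have "openin pointwise_topology ({f. apply_bcontfun f y \<in> {-r<..<r}} \<inter> {f. \<forall>y\<in>S. \<bar>apply_bcontfun f y\<bar> < r})"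
    using insert.IH by (rule openin_Int)
  moreover have "{f. apply_bcontfun f y \<in> {-r<..<r}} \<inter> {f. \<forall>y\<in>S. \<bar>apply_bcontfun f y\<bar> < r} =
      {f. \<forall>y\<in>insert y S. \<bar>apply_bcontfun f y\<bar> < r}"
    by (simp add: set_eq_iff abs_less_iff) linarith
  ultimately show ?case by simp
qed

text \<open>The countable set of functions is only a rational vector space, whereas eliminating
  functionals needs a real one. Real multiples are limits of rational multiples.\<close>

lemma subspace_closure_rational:
  fixes A :: "'b::real_normed_vector set"
  assumes zero: "0 \<in> A" and add: "\<And>f g. f \<in> A \<Longrightarrow> g \<in> A \<Longrightarrow> f + g \<in> A"
    and scale: "\<And>r f. r \<in> \<rat> \<Longrightarrow> f \<in> A \<Longrightarrow> r *\<^sub>R f \<in> A"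
  shows "subspace (closure A)"
proof (rule subspaceI)
  show "0 \<in> closure A" using zero closure_subset by blast
next
  fix f g assume "f \<in> closure A" "g \<in> closure A"
  then obtain u v where u: "\<forall>n. u n \<in> A" "u \<longlonglongrightarrow> f" and v: "\<forall>n. v n \<in> A" "v \<longlonglongrightarrow> g"
    unfolding closure_sequential by (elim exE conjE)
  have "(\<lambda>n. u n + v n) \<longlonglongrightarrow> f + g" by (rule tendsto_add[OF u(2) v(2)])
  moreover have "\<forall>n. u n + v n \<in> A" using u(1) v(1) add by simp
  ultimately show "f + g \<in> closure A" unfolding closure_sequential by (intro exI[of _ "\<lambda>n. u n + v n"] conjI)
next
  fix c :: real and f assume "f \<in> closure A"
  then obtain u where u: "\<forall>n. u n \<in> A" "u \<longlonglongrightarrow> f"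
    unfolding closure_sequential by (elim exE conjE)
  have "\<exists>r. r \<in> \<rat> \<and> c < r \<and> r < c + inverse (real (Suc n))" for n
    using Rats_dense_in_real[of c "c + inverse (real (Suc n))"] by (simp add: Bex_def)
  then obtain r where r: "\<And>n. r n \<in> \<rat> \<and> c < r n \<and> r n < c + inverse (real (Suc n))"
    by metis
  have "(\<lambda>n. c + inverse (real (Suc n))) \<longlonglongrightarrow> c + 0"
    by (intro tendsto_add tendsto_const LIMSEQ_inverse_real_of_nat)
  then have "r \<longlonglongrightarrow> c"
    by (intro tendsto_sandwich[of "\<lambda>_. c" r sequentially "\<lambda>n. c + inverse (real (Suc n))"])
      (use r in \<open>simp_all add: less_imp_le\<close>)
  then have "(\<lambda>n. r n *\<^sub>R u n) \<longlonglongrightarrow> c *\<^sub>R f" using u(2) by (rule tendsto_scaleR)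
  moreover have "\<forall>n. r n *\<^sub>R u n \<in> A" using u(1) r scale by simp
  ultimately show "c *\<^sub>R f \<in> closure A" unfolding closure_sequential by (intro exI[of _ "\<lambda>n. r n *\<^sub>R u n"] conjI)
qed

text \<open>The sequence e enumerates the closed-off countable set, repetitions allowed; x gives the
  atoms of the measures, and \<open>separated\<close> keeps them apart in M. The number d bounds the
  dimension, with colors 0 to d.\<close>

locale countable_homeomorphism =
  fixes \<Phi> \<Psi> :: "('a::topological_space \<Rightarrow>\<^sub>C real) \<Rightarrow> ('a \<Rightarrow>\<^sub>C real)"
    and e :: "nat \<Rightarrow> ('a \<Rightarrow>\<^sub>C real)" and x :: "nat \<Rightarrow> 'a" and d :: nat
  assumes \<Phi>: "continuous_map pointwise_topology weak_topology \<Phi>"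
    and \<Psi>: "continuous_map weak_topology pointwise_topology \<Psi>"
    and \<Psi>\<Phi>: "\<Psi> (\<Phi> f) = f" and \<Phi>\<Psi>: "\<Phi> (\<Psi> f) = f"
    and compact: "compact (UNIV :: 'a set)"
    and algebra: "rational_lattice_algebra (range (\<lambda>k. apply_bcontfun (e k)))"
    and \<Phi>_range: "f \<in> range e \<Longrightarrow> \<Phi> f \<in> range e"
    and \<Psi>_range: "f \<in> range e \<Longrightarrow> \<Psi> f \<in> range e"
    and separated: "i \<noteq> j \<Longrightarrow> \<exists>k. apply_bcontfun (e k) (x i) \<noteq> apply_bcontfun (e k) (x j)"
    and colored: "\<And>F. finite F \<Longrightarrow> F \<subseteq> range (\<lambda>k. apply_bcontfun (e k)) \<Longrightarrow> (\<And>y. \<exists>f\<in>F. 0 < f y) \<Longrightarrow>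
      \<exists>B. colored_functions d F B \<and> (\<forall>c\<le>d. B c \<subseteq> range (\<lambda>k. apply_bcontfun (e k)))"
begin

lemma mem_range_e: "f \<in> range e \<longleftrightarrow> apply_bcontfun f \<in> range (\<lambda>k. apply_bcontfun (e k))"
  by (auto simp: image_iff apply_bcontfun_inject)

lemma range_e_add: "f \<in> range e \<Longrightarrow> g \<in> range e \<Longrightarrow> f + g \<in> range e"
  using rational_lattice_algebraD(2)[OF algebra, of f g] unfolding mem_range_e by simp

lemma range_e_scale: "r \<in> \<rat> \<Longrightarrow> f \<in> range e \<Longrightarrow> r *\<^sub>R f \<in> range e"
  using rational_lattice_algebraD(3)[OF algebra rational_lattice_algebraD(1)[OF algebra], of r f]
  unfolding mem_range_e by simp

lemma range_e_zero: "0 \<in> range e"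
  using range_e_scale[of 0 "e 0"] by simp

lemma subspace_closure_range_e: "subspace (closure (range e))"
  by (rule subspace_closure_rational[OF range_e_zero range_e_add range_e_scale])

text \<open>The quotient map onto M, realized as \<open>range q\<close>. The value of
  \<open>e k\<close> at a point of M is just its coordinate k.\<close>

definition q :: "'a \<Rightarrow> nat \<Rightarrow> real" where
  "q y = (\<lambda>k. apply_bcontfun (e k) y)"

text \<open>Subtracting \<open>\<Phi> 0\<close> normalizes the possibly nonlinear map so that
  \<open>L t 0 = 0\<close>.\<close>

definition L :: "(nat \<Rightarrow> real) \<Rightarrow> ('a \<Rightarrow>\<^sub>C real) \<Rightarrow> real" where
  "L t f = weighted_sum x t (\<Phi> f - \<Phi> 0)"

text \<open>Testing only the functions \<open>e k\<close> makes this a condition on t and the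
  coordinates of the points of B. The strict premise and the weak conclusion make the condition
  closed.\<close>

definition works :: "nat \<Rightarrow> (nat \<Rightarrow> real) \<Rightarrow> (nat \<Rightarrow> real) set \<Rightarrow> bool" where
  "works n t B \<longleftrightarrow> (\<forall>k. (\<forall>b\<in>B. \<bar>b k\<bar> < 1 / Suc n) \<longrightarrow> \<bar>L t (e k)\<bar> \<le> 1)"

abbreviation Z :: "nat \<Rightarrow> (nat \<Rightarrow> nat \<Rightarrow> real) set" where
  "Z m \<equiv> tuples m (range q) (\<lambda>_. 0)"

definition E :: "nat \<Rightarrow> nat \<Rightarrow> ((nat \<Rightarrow> real) \<times> (nat \<Rightarrow> nat \<Rightarrow> real)) set" where
  "E n m = {(t, z). t \<in> hilbert_cube \<and> z \<in> Z m \<and> works n t (z ` {..<m})}"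

lemma continuous_q: "continuous_on UNIV q"
  unfolding q_def by (rule continuous_on_coordinatewise_then_product) simp

lemma compact_range_q: "compact (range q)"
  using compact_continuous_image[OF continuous_q compact] .

text \<open>Each k contributes a closed alternative: some entry has absolute value at least
  \<open>1 / Suc n\<close> at k, or \<open>L t (e k)\<close> is at most 1 in absolute value.\<close>

lemma compact_E: "compact (E n m)"
proof -
  define H where "H = hilbert_cube \<times> Z m"
  have H: "compact H"
    unfolding H_def by (intro compact_Times compact_hilbert_cube compact_tuples compact_range_q)
  define C where "C k i = H \<inter> (\<lambda>p. \<bar>snd p i k\<bar>) -` {1 / Suc n..}" for k i
  define D where "D k = H \<inter> (\<lambda>p. \<bar>L (fst p) (e k)\<bar>) -` {..1}" for k
  have "closed (C k i)" for k i
    unfolding C_def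
  proof (rule continuous_closed_preimage)
    have "continuous_on UNIV (\<lambda>z::nat \<Rightarrow> nat \<Rightarrow> real. z i k)"
      by (rule continuous_on_product_then_coordinatewise[OF continuous_on_product_coordinates])
    from continuous_on_compose2[OF this continuous_on_snd[OF continuous_on_id]]
    show "continuous_on H (\<lambda>p. \<bar>snd p i k\<bar>)" by (intro continuous_on_rabs) simp
  qed (use H compact_imp_closed in auto)
  moreover have "closed (D k)" for k
    unfolding D_def
  proof (rule continuous_closed_preimage)
    have "continuous_on H (\<lambda>p. L (fst p) (e k))"
      unfolding L_def H_def
      by (rule continuous_on_compose2[OF continuous_on_weighted_sum continuous_on_fst[OF continuous_on_id]]) auto
    then show "continuous_on H (\<lambda>p. \<bar>L (fst p) (e k)\<bar>)" by (rule continuous_on_rabs)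
  qed (use H compact_imp_closed in auto)
  ultimately have "closed (\<Inter>k. (\<Union>i<m. C k i) \<union> D k)"
    by (intro closed_INT ballI closed_Un closed_UN) simp_all
  then have "compact (H \<inter> (\<Inter>k. (\<Union>i<m. C k i) \<union> D k))" by (rule compact_Int_closed[OF H])
  moreover have "p \<in> E n m \<longleftrightarrow> p \<in> H \<inter> (\<Inter>k. (\<Union>i<m. C k i) \<union> D k)" for p
  proof (cases "p \<in> H")
    case True
    have "p \<in> (\<Union>i<m. C k i) \<union> D k \<longleftrightarrow> ((\<forall>i<m. \<bar>snd p i k\<bar> < 1 / Suc n) \<longrightarrow> \<bar>L (fst p) (e k)\<bar> \<le> 1)" for k
      using True unfolding C_def D_def by (auto simp: not_less)
    moreover have "p \<in> E n m \<longleftrightarrow> works n (fst p) (snd p ` {..<m})"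
      using True unfolding E_def H_def by (simp add: case_prod_beta mem_Times_iff)
    moreover have "(\<forall>b\<in>snd p ` {..<m}. \<bar>b k\<bar> < 1 / Suc n) \<longleftrightarrow> (\<forall>i<m. \<bar>snd p i k\<bar> < 1 / Suc n)" for k
      by auto
    ultimately show ?thesis using True unfolding works_def by simp
  next
    case False
    then have "p \<notin> E n m" unfolding E_def H_def by (auto simp: case_prod_beta mem_Times_iff)
    then show ?thesis using False by simp
  qed
  then have "E n m = H \<inter> (\<Inter>k. (\<Union>i<m. C k i) \<union> D k)" by (rule set_eqI)
  ultimately show ?thesis by simp
qed

lemma bounded_linear_weighted_sum_cube: "t \<in> hilbert_cube \<Longrightarrow> bounded_linear (weighted_sum x t)"
  by (rule bounded_linear_weighted_sum[of t 1]) (rule hilbert_cube_bound)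

section \<open>Finite sets that control a functional\<close>

text \<open>Continuity is wanted at arbitrary g: at 0 it yields a controlling set, and at members of
  e it confines the failure of a smaller set to finitely many points.\<close>

lemma pointwise_control:
  assumes t: "t \<in> hilbert_cube" and "0 < \<epsilon>"
  shows "\<exists>S \<delta>. finite S \<and> 0 < \<delta> \<and> (\<forall>f. (\<forall>y\<in>S. \<bar>apply_bcontfun f y - apply_bcontfun g y\<bar> < \<delta>) \<longrightarrow> \<bar>L t f - L t g\<bar> < \<epsilon>)"
proof -
  note lin = bounded_linear_weighted_sum_cube[OF t]
  define V where "V = weighted_sum x t -` ball (weighted_sum x t (\<Phi> g)) \<epsilon>"
  have "openin weak_topology V"
    unfolding V_def by (rule openin_weak_topology_vimage[OF lin open_ball])
  from openin_continuous_map_preimage[OF \<Phi> this]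
  have "openin pointwise_topology {f. \<Phi> f \<in> V}" by (simp add: topspace_pointwise_topology)
  moreover have "g \<in> {f. \<Phi> f \<in> V}" unfolding V_def using \<open>0 < \<epsilon>\<close> by simp
  ultimately obtain S \<delta> where S: "finite S" "0 < \<delta>"
    "\<forall>f. (\<forall>y\<in>S. \<bar>apply_bcontfun f y - apply_bcontfun g y\<bar> < (\<delta>::real)) \<longrightarrow> f \<in> {f. \<Phi> f \<in> V}"
    using openin_pointwise_topology_nhd by metis
  have "\<bar>L t f - L t g\<bar> < \<epsilon>" if "f \<in> {f. \<Phi> f \<in> V}" for f
    using that unfolding V_def L_def
    by (simp add: linear_diff[OF bounded_linear.linear[OF lin]] dist_real_def abs_minus_commute)
  then show ?thesis using S by (intro exI[of _ S] exI[of _ \<delta>] conjI allI impI) simp_all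
qed

lemma L_zero: "L t 0 = 0"
  unfolding L_def weighted_sum_def by simp

lemma works_exists:
  assumes t: "t \<in> hilbert_cube"
  shows "\<exists>n B. finite B \<and> B \<subseteq> range q \<and> works n t B"
proof -
  obtain S \<delta> where S: "finite S" "0 < \<delta>"
      "\<forall>f. (\<forall>y\<in>S. \<bar>apply_bcontfun f y - apply_bcontfun 0 y\<bar> < (\<delta>::real)) \<longrightarrow> \<bar>L t f - L t 0\<bar> < 1"
    using pointwise_control[OF t zero_less_one, of 0] by (elim exE conjE)
  obtain n where n: "inverse (real (Suc n)) < \<delta>" using reals_Archimedean[OF S(2)] by blast
  have "works n t (q ` S)"
    unfolding works_def
  proof (intro allI impI)
    fix k assume k: "\<forall>b\<in>q ` S. \<bar>b k\<bar> < 1 / real (Suc n)"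
    have "\<bar>apply_bcontfun (e k) y - apply_bcontfun 0 y\<bar> < \<delta>" if "y \<in> S" for y
    proof -
      have "\<bar>q y k\<bar> < 1 / real (Suc n)" using k that by simp
      then show ?thesis using n by (simp add: q_def inverse_eq_divide)
    qed
    then have "\<bar>L t (e k) - L t 0\<bar> < 1" using S(3) by simp
    then show "\<bar>L t (e k)\<bar> \<le> 1" by (simp add: L_zero)
  qed
  then show ?thesis using S(1) by (intro exI[of _ n] exI[of _ "q ` S"] conjI) auto
qed

lemma separate_q:
  assumes "finite P" "finite R" "P \<subseteq> range q" "R \<subseteq> range q" "P \<inter> R = {}"
  shows "\<exists>k. (\<forall>y. 0 \<le> apply_bcontfun (e k) y \<and> apply_bcontfun (e k) y \<le> 1) \<and>
    (\<forall>p\<in>P. p k = 1) \<and> (\<forall>r\<in>R. r k = 0)"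
proof -
  obtain P' where P': "finite P'" "P = q ` P'" using finite_subset_image[OF assms(1,3)] by blast
  obtain R' where R': "finite R'" "R = q ` R'" using finite_subset_image[OF assms(2,4)] by blast
  have sep: "\<exists>f\<in>range (\<lambda>k. apply_bcontfun (e k)). f p \<noteq> f r" if "p \<in> P'" "r \<in> R'" for p r
  proof -
    have "q p \<noteq> q r" using that P'(2) R'(2) assms(5) by blast
    then obtain k where "q p k \<noteq> q r k" by (auto simp: fun_eq_iff)
    then show ?thesis unfolding q_def by (intro bexI[of _ "apply_bcontfun (e k)"] rangeI)
  qed
  have "\<exists>h\<in>range (\<lambda>k. apply_bcontfun (e k)). (\<forall>y. 0 \<le> h y \<and> h y \<le> 1) \<and>
      (\<forall>p\<in>P'. h p = 1) \<and> (\<forall>r\<in>R'. h r = 0)"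
    by (rule rational_lattice_algebra_separate_finite[OF algebra P'(1) R'(1)]) (rule sep)
  then obtain h where h: "h \<in> range (\<lambda>k. apply_bcontfun (e k))" "\<forall>y. 0 \<le> h y \<and> h y \<le> 1"
    "\<forall>p\<in>P'. h p = 1" "\<forall>r\<in>R'. h r = 0" by (elim bexE conjE)
  obtain k where k: "h = apply_bcontfun (e k)" using h(1) by (elim rangeE)
  show ?thesis
  proof (intro exI[of _ k] conjI ballI)
    show "\<forall>y. 0 \<le> apply_bcontfun (e k) y \<and> apply_bcontfun (e k) y \<le> 1" using h(2) k by simp
    show "p k = 1" if "p \<in> P" for p using that h(3) P'(2) k by (auto simp: q_def)
    show "r k = 0" if "r \<in> R" for r using that h(4) R'(2) k by (auto simp: q_def)
  qed
qed

lemma inj_q_x: "q (x i) = q (x j) \<Longrightarrow> i = j"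
  using separated[of i j] unfolding q_def by (metis (no_types))

text \<open>The functions in e tell the measures apart. One that is 1 at \<open>x i\<close> and 0 at
  every other \<open>x j\<close> with j at most n bounds \<open>u i\<close> by a tail, and n is
  arbitrary.\<close>

lemma weights_zero:
  assumes u: "\<And>j. \<bar>u j\<bar> \<le> C" and zero: "\<And>h. h \<in> range e \<Longrightarrow> weighted_sum x u h = 0"
  shows "u i = 0"
proof -
  have bound: "\<bar>u i * (1/2)^i\<bar> \<le> C * (1/2)^n" if "i \<le> n" for n
  proof -
    have "q (x i) \<notin> (\<lambda>j. q (x j)) ` ({..n} - {i})" using inj_q_x by blast
    then obtain k where k: "\<forall>y. 0 \<le> apply_bcontfun (e k) y \<and> apply_bcontfun (e k) y \<le> 1"
        "\<forall>p\<in>{q (x i)}. p k = 1" "\<forall>r\<in>(\<lambda>j. q (x j)) ` ({..n} - {i}). r k = 0"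
      using separate_q[of "{q (x i)}" "(\<lambda>j. q (x j)) ` ({..n} - {i})"] by auto
    show ?thesis
    proof (rule weighted_sum_tail_bound[OF u _ that, where g = "e k"])
      show "\<bar>apply_bcontfun (e k) y\<bar> \<le> 1" for y using k(1)[THEN spec[of _ y]] by simp
      show "apply_bcontfun (e k) (x i) = 1" using k(2) by (simp add: q_def)
      show "apply_bcontfun (e k) (x j) = 0" if "j \<le> n" "j \<noteq> i" for j
        using k(3)[THEN bspec[of _ _ "q (x j)"]] that by (simp add: q_def)
      show "weighted_sum x u (e k) = 0" using zero by simp
    qed
  qed
  have "(\<lambda>n. C * (1/2::real)^n) \<longlonglongrightarrow> C * 0"
    by (intro tendsto_mult tendsto_const LIMSEQ_power_zero) simp
  then have "\<bar>u i * (1/2)^i\<bar> \<le> C * 0"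
    by (rule Lim_bounded2[where N = i]) (use bound in simp)
  then show ?thesis by simp
qed

text \<open>For a suitable n the set B has least cardinality, and z enumerates it. A different
  related tuple agrees with z only on a proper subset T of the indices, and by minimality the
  entries with index in T do not suffice. If the remaining entries avoid the finitely many points
  witnessing this, the whole tuple cannot suffice either.\<close>

lemma works_isolated:
  assumes t: "t \<in> hilbert_cube"
  shows "\<exists>n m z U. open U \<and> z \<in> U \<and> {z' \<in> U. (t, z') \<in> E n m} = {z}"
proof -
  obtain n B0 where "finite B0 \<and> B0 \<subseteq> range q \<and> works n t B0" using works_exists[OF t] by blast
  from ex_has_least_nat[of "\<lambda>B. finite B \<and> B \<subseteq> range q \<and> works n t B", OF this, of card]
  obtain B where B: "finite B" "B \<subseteq> range q" "works n t B"
    and least: "\<forall>B'. finite B' \<and> B' \<subseteq> range q \<and> works n t B' \<longrightarrow> card B \<le> card B'"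
    by (elim exE conjE)
  define m where "m = card B"
  obtain z0 where z0: "bij_betw z0 {..<m} B"
    using ex_bij_betw_nat_finite[OF B(1)] unfolding m_def atLeast0LessThan by blast
  define z where "z i = (if i < m then z0 i else (\<lambda>_. 0))" for i
  have z_image: "z ` {..<m} = B"
    using z0 unfolding bij_betw_def z_def by auto
  have zZ: "z \<in> Z m"
    unfolding mem_tuples
  proof (intro conjI allI impI)
    show "z i \<in> range q" if "i < m" for i using that z_image B(2) by blast
    show "z i = (\<lambda>_. 0)" if "m \<le> i" for i using that by (simp add: z_def)
  qed
  \<comment> \<open>Failure is recorded so as to survive any change of the function off the finite
    set S.\<close>
  define fails where "fails T k S \<longleftrightarrow> (\<forall>b\<in>z ` T. \<bar>b k\<bar> < 1 / Suc n) \<and> finite S \<and>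
      (\<forall>f. (\<forall>y\<in>S. apply_bcontfun f y = apply_bcontfun (e k) y) \<longrightarrow> 1 < \<bar>L t f\<bar>)" for T k S
  have "\<exists>k S. fails T k S" if T: "T \<subset> {..<m}" for T
  proof -
    have finT: "finite T" using T finite_subset by blast
    have "card (z ` T) \<le> card T" using finT by (rule card_image_le)
    also have "card T < m" using psubset_card_mono[OF _ T] by simp
    finally have "\<not> card B \<le> card (z ` T)" unfolding m_def by simp
    moreover have "finite (z ` T)" "z ` T \<subseteq> range q" using finT T z_image B(2) by blast+
    ultimately have "\<not> works n t (z ` T)" using least by blast
    then obtain k where k: "\<forall>b\<in>z ` T. \<bar>b k\<bar> < 1 / Suc n" "1 < \<bar>L t (e k)\<bar>"
      unfolding works_def by (auto simp: not_le)
    then have "0 < \<bar>L t (e k)\<bar> - 1" by simp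
    from pointwise_control[OF t this, of "e k"]
    obtain S \<delta> where S: "finite S" "(0::real) < \<delta>"
      "\<forall>f. (\<forall>y\<in>S. \<bar>apply_bcontfun f y - apply_bcontfun (e k) y\<bar> < \<delta>) \<longrightarrow> \<bar>L t f - L t (e k)\<bar> < \<bar>L t (e k)\<bar> - 1"
      by (elim exE conjE)
    have "1 < \<bar>L t f\<bar>" if "\<forall>y\<in>S. apply_bcontfun f y = apply_bcontfun (e k) y" for f
    proof -
      have "\<bar>L t f - L t (e k)\<bar> < \<bar>L t (e k)\<bar> - 1" using S(2,3) that by simp
      then show ?thesis by linarith
    qed
    then have "fails T k S" unfolding fails_def using k(1) S(1) by simp
    then show ?thesis by blast
  qed
  then obtain k S where fails: "\<And>T. T \<subset> {..<m} \<Longrightarrow> fails T (k T) (S T)"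
    by metis
  have S: "\<forall>b\<in>z ` T. \<bar>b (k T)\<bar> < 1 / Suc n" "finite (S T)"
      "\<forall>f. (\<forall>y\<in>S T. apply_bcontfun f y = apply_bcontfun (e (k T)) y) \<longrightarrow> 1 < \<bar>L t f\<bar>"
    if "T \<subset> {..<m}" for T
    using fails[OF that] unfolding fails_def by simp_all
  define X where "X = B \<union> (\<Union>T\<in>{T. T \<subset> {..<m}}. q ` S T)"
  have finX: "finite X"
  proof -
    have "finite {T. T \<subset> {..<m}}" by (rule finite_subset[of _ "Pow {..<m}"]) auto
    then show ?thesis unfolding X_def using B(1) S(2) by (intro finite_UnI finite_UN_I finite_imageI) simp_all
  qed
  have Xq: "X \<subseteq> range q" unfolding X_def using B(2) by blast
  \<comment> \<open>A tuple in U either agrees with z at i or has its entry i outside X, that is,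
    off B and all witnesses.\<close>
  define U where "U = (\<Inter>i<m. \<Inter>b\<in>X - {z i}. {z'::nat \<Rightarrow> nat \<Rightarrow> real. z' i \<noteq> b})"
  have "open U"
    unfolding U_def using finX
    by (intro open_INT ballI finite_lessThan finite_Diff open_Collect_neq continuous_on_const continuous_on_product_coordinates)
  moreover have zU: "z \<in> U" unfolding U_def by auto
  moreover have "{z' \<in> U. (t, z') \<in> E n m} = {z}"
  proof -
    have "(t, z) \<in> E n m" unfolding E_def using t zZ B(3) z_image by simp
    moreover have False if z': "z' \<in> U" "(t, z') \<in> E n m" "z' \<noteq> z" for z'
    proof -
      have z'Z: "z' \<in> Z m" and z'works: "works n t (z' ` {..<m})"
        using z'(2) unfolding E_def by simp_all
      define T where "T = {i. i < m \<and> z' i = z i}"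
      have "\<exists>i<m. z' i \<noteq> z i"
      proof (rule ccontr)
        assume "\<not> (\<exists>i<m. z' i \<noteq> z i)"
        moreover have "z' i = z i" if "m \<le> i" for i using zZ z'Z that unfolding mem_tuples by simp
        ultimately have "z' i = z i" for i by (cases "i < m") simp_all
        then show False using z'(3) by (simp add: fun_eq_iff)
      qed
      then have T: "T \<subset> {..<m}" unfolding T_def by auto
      \<comment> \<open>Multiplying the witness that \<open>z ` T\<close> fails by a function that vanishes at the other
        entries of \<open>z'\<close> contradicts \<open>works n t (z' ` {..<m})\<close>.\<close>
      define R where "R = z' ` ({..<m} - T)"
      have "z' i \<notin> X" if i: "i < m" "i \<notin> T" for i
      proof
        assume "z' i \<in> X"
        moreover have "z' i \<noteq> z i" using i unfolding T_def by simp
        ultimately have "z' i \<in> X - {z i}" by simp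
        then show False using z'(1) i(1) unfolding U_def by blast
      qed
      then have XR: "X \<inter> R = {}" unfolding R_def by blast
      have finR: "finite R" unfolding R_def by simp
      have Rq: "R \<subseteq> range q"
      proof
        fix r assume "r \<in> R"
        then obtain i where "i < m" "r = z' i" unfolding R_def by blast
        then show "r \<in> range q" using z'Z unfolding mem_tuples by simp
      qed
      obtain h where h: "\<forall>p\<in>X. p h = 1" "\<forall>r\<in>R. r h = 0"
        using separate_q[OF finX finR Xq Rq XR] by (elim exE conjE)
      have "(\<lambda>y. apply_bcontfun (e (k T)) y * apply_bcontfun (e h) y) \<in> range (\<lambda>k. apply_bcontfun (e k))"
        by (intro rational_lattice_algebraD(3)[OF algebra] rangeI)
      then obtain k' where "(\<lambda>y. apply_bcontfun (e (k T)) y * apply_bcontfun (e h) y) = apply_bcontfun (e k')"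
        by (elim rangeE)
      then have k': "apply_bcontfun (e k') y = apply_bcontfun (e (k T)) y * apply_bcontfun (e h) y" for y
        by (rule fun_cong[symmetric])
      have k'_coord: "w k' = w (k T) * w h" if "w \<in> range q" for w
        using that k' unfolding q_def by auto
      have "\<bar>b k'\<bar> < 1 / Suc n" if b: "b \<in> z' ` {..<m}" for b
      proof -
        from b obtain i where i: "i < m" "b = z' i" by blast
        have bq: "b \<in> range q" using i z'Z unfolding mem_tuples by simp
        show ?thesis
        proof (cases "i \<in> T")
          case True
          then have "b = z i" unfolding T_def using i by simp
          then have "b \<in> X" unfolding X_def using z_image i(1) by blast
          then have "b k' = b (k T)" using k'_coord[OF bq] h(1) by simp
          moreover have "\<bar>b (k T)\<bar> < 1 / Suc n" using S(1)[OF T] True \<open>b = z i\<close> by blast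
          ultimately show ?thesis by simp
        next
          case False
          then have "b \<in> R" unfolding R_def using i by blast
          then have "b h = 0" using h(2) by blast
          then show ?thesis using k'_coord[OF bq] by simp
        qed
      qed
      then have "\<bar>L t (e k')\<bar> \<le> 1" using z'works unfolding works_def by blast
      moreover have "apply_bcontfun (e k') y = apply_bcontfun (e (k T)) y" if "y \<in> S T" for y
      proof -
        have "q y \<in> X" unfolding X_def using that T by blast
        then have "q y h = 1" using h(1) by blast
        then show ?thesis unfolding k' by (simp add: q_def)
      qed
      then have "1 < \<bar>L t (e k')\<bar>" using S(3)[OF T] by simp
      ultimately show False by simp
    qed
    ultimately show ?thesis using zU by blast
  qed
  ultimately show ?thesis by blast
qed

section \<open>Parameters that share a tuple\<close>

text \<open>The point is that F does not depend on t. It comes from continuity of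
  \<open>\<Psi>\<close> at \<open>\<Phi> 0\<close>: if F is small at h, then
  \<open>\<Psi> (h + \<Phi> 0)\<close> is small at the points of z. Applying L to it gives exactly
  \<open>weighted_sum x t h\<close>, which is thus at most 1 in absolute value; scaling then forces
  0 on the common kernel.\<close>

lemma fibre_functionals:
  assumes z: "z \<in> Z m"
  shows "\<exists>F. finite F \<and> (\<forall>\<nu>\<in>F. bounded_linear \<nu>) \<and>
    (\<forall>t h. (t, z) \<in> E n m \<longrightarrow> h \<in> closure (range e) \<longrightarrow> (\<forall>\<nu>\<in>F. \<nu> h = (0::real)) \<longrightarrow> weighted_sum x t h = 0)"
proof -
  have "\<forall>i. \<exists>y. i < m \<longrightarrow> z i = q y" using z unfolding mem_tuples by blast
  then obtain y where y: "\<forall>i. i < m \<longrightarrow> z i = q (y i)" by (rule choice[THEN exE])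
  define W where "W = {f. \<forall>u\<in>y ` {..<m}. \<bar>apply_bcontfun f u\<bar> < 1 / Suc n}"
  have "openin pointwise_topology W"
    unfolding W_def by (rule openin_pointwise_topology_small) simp
  from openin_continuous_map_preimage[OF \<Psi> this]
  have "openin weak_topology {g. \<Psi> g \<in> W}" by (simp add: topspace_weak_topology)
  moreover have "\<Phi> 0 \<in> {g. \<Psi> g \<in> W}" by (simp add: \<Psi>\<Phi> W_def)
  ultimately obtain F \<delta> where F: "finite F" "\<forall>\<nu>\<in>F. bounded_linear \<nu>" "0 < \<delta>"
      "\<forall>g. (\<forall>\<nu>\<in>F. \<bar>\<nu> g - \<nu> (\<Phi> 0)\<bar> < (\<delta>::real)) \<longrightarrow> g \<in> {g. \<Psi> g \<in> W}"
    using openin_weak_topology_nhd by metis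
  have bound: "\<bar>weighted_sum x t h\<bar> \<le> 1"
    if t: "(t, z) \<in> E n m" and h: "h \<in> range e" "\<forall>\<nu>\<in>F. \<bar>\<nu> h\<bar> < \<delta>" for t h
  proof -
    define g where "g = h + \<Phi> 0"
    have g: "g \<in> range e" unfolding g_def by (intro range_e_add h(1) \<Phi>_range range_e_zero)
    then have "\<Psi> g \<in> range e" by (rule \<Psi>_range)
    then obtain k where k: "\<Psi> g = e k" by (elim rangeE)
    have "\<bar>\<nu> g - \<nu> (\<Phi> 0)\<bar> < \<delta>" if "\<nu> \<in> F" for \<nu>
    proof -
      have "linear \<nu>" using F(2) that bounded_linear.linear by blast
      then show ?thesis using h(2) that unfolding g_def by (simp add: linear_add)
    qed
    then have "\<Psi> g \<in> W" using F(4)[THEN spec[of _ g]] by simp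
    then have "e k \<in> W" by (simp add: k)
    have "\<bar>b k\<bar> < 1 / Suc n" if "b \<in> z ` {..<m}" for b
    proof -
      from that obtain i where "i < m" "b = z i" by blast
      then have "b = q (y i)" "y i \<in> y ` {..<m}" using y by simp_all
      moreover from this(2) have "\<bar>apply_bcontfun (e k) (y i)\<bar> < 1 / Suc n"
        using \<open>e k \<in> W\<close> unfolding W_def by blast
      ultimately show ?thesis by (simp add: q_def)
    qed
    then have "\<bar>L t (e k)\<bar> \<le> 1" using t unfolding E_def works_def by blast
    then show ?thesis unfolding L_def k[symmetric] \<Phi>\<Psi> g_def by simp
  qed
  have "weighted_sum x t h = 0"
    if t: "(t, z) \<in> E n m" and h: "h \<in> closure (range e)" "\<forall>\<nu>\<in>F. \<nu> h = 0" for t h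
  proof (rule ccontr)
    assume ne: "weighted_sum x t h \<noteq> 0"
    have lin: "bounded_linear (weighted_sum x t)"
      using t unfolding E_def by (intro bounded_linear_weighted_sum_cube) simp
    \<comment> \<open>The functional takes the value 2 at g, beyond the bound 1. That bound concerns
      members of e only, which a real multiple of h need not be, hence the approximation by
      u.\<close>
    define g where "g = (2 / weighted_sum x t h) *\<^sub>R h"
    have "g \<in> closure (range e)"
      unfolding g_def by (rule subspace_scale[OF subspace_closure_range_e h(1)])
    then obtain u where u: "\<forall>j. u j \<in> range e" "u \<longlonglongrightarrow> g"
      unfolding closure_sequential by (elim exE conjE)
    have "\<forall>\<^sub>F j in sequentially. \<bar>\<nu> (u j)\<bar> < \<delta>" if "\<nu> \<in> F" for \<nu>
    proof -
      have \<nu>: "bounded_linear \<nu>" using F(2) that by blast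
      have "\<nu> g = 0" unfolding g_def using h(2) that by (simp add: linear_scale[OF bounded_linear.linear[OF \<nu>]])
      then have "(\<lambda>j. \<bar>\<nu> (u j)\<bar>) \<longlonglongrightarrow> 0"
        using tendsto_rabs[OF bounded_linear.tendsto[OF \<nu> u(2)]] by simp
      then show ?thesis using F(3) by (rule order_tendstoD(2))
    qed
    then have "\<forall>\<^sub>F j in sequentially. \<forall>\<nu>\<in>F. \<bar>\<nu> (u j)\<bar> < \<delta>"
      using F(1) by (simp add: eventually_ball_finite)
    moreover have "\<forall>\<^sub>F j in sequentially. 1 < weighted_sum x t (u j)"
    proof (rule order_tendstoD(1)[OF bounded_linear.tendsto[OF lin u(2)]])
      show "1 < weighted_sum x t g"
        unfolding g_def using ne by (simp add: linear_scale[OF bounded_linear.linear[OF lin]])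
    qed
    ultimately have "\<forall>\<^sub>F j in sequentially. (\<forall>\<nu>\<in>F. \<bar>\<nu> (u j)\<bar> < \<delta>) \<and> 1 < weighted_sum x t (u j)"
      by (rule eventually_conj)
    then obtain j where j: "\<forall>\<nu>\<in>F. \<bar>\<nu> (u j)\<bar> < \<delta>" "1 < weighted_sum x t (u j)"
      by (auto simp: eventually_sequentially)
    then show False using bound[OF t _ j(1)] u(1) by fastforce
  qed
  then show ?thesis using F(1,2) by (intro exI[of _ F] conjI allI impI) simp_all
qed

text \<open>On the closure of \<open>range e\<close> at most \<open>card F\<close> functionals
  vanishing on the common kernel of F can be independent, while weights are determined by their
  sums. If every choice of values on I were attained, one difference of parameters for each element
  of I would contradict this.\<close>

lemma misses_cube_points_fibre:
  assumes z: "z \<in> Z m"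
  shows "misses_cube_points {t. (t, z) \<in> E n m}"
proof -
  obtain F where F: "finite F" "\<forall>\<nu>\<in>F. bounded_linear \<nu>"
    "\<forall>t h. (t, z) \<in> E n m \<longrightarrow> h \<in> closure (range e) \<longrightarrow> (\<forall>\<nu>\<in>F. \<nu> h = (0::real)) \<longrightarrow> weighted_sum x t h = 0"
    using fibre_functionals[OF z, of n] by (elim exE conjE)
  have "\<exists>c. (\<forall>i\<in>I. 0 < c i \<and> c i < 1) \<and> (\<forall>t\<in>{t. (t, z) \<in> E n m}. \<exists>i\<in>I. t i \<noteq> c i)"
    if I: "finite I \<and> card I = Suc (card F)" for I
  proof (rule ccontr)
    assume neg: "\<not> ?thesis"
    have hit: "\<exists>t. (t, z) \<in> E n m \<and> (\<forall>i\<in>I. t i = c i)" if "\<forall>i\<in>I. 0 < c i \<and> c i < 1" for c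
      using neg that by blast
    \<comment> \<open>Any two distinct values in (0, 1) would do in place of 1/2 and 3/4. Within I,
      \<open>t l\<close> differs from \<open>t0\<close> only at l; outside I nothing is
      known.\<close>
    obtain t0 where t0: "(t0, z) \<in> E n m" "\<forall>i\<in>I. t0 i = 1/2"
      using hit[of "\<lambda>_. 1/2"] by auto
    have "\<forall>l. \<exists>t. (t, z) \<in> E n m \<and> (\<forall>i\<in>I. t i = (if i = l then 3/4 else 1/2))"
      by (intro allI hit) simp
    then obtain t where t: "\<forall>l. (t l, z) \<in> E n m \<and> (\<forall>i\<in>I. t l i = (if i = l then 3/4 else 1/2))"
      by (rule choice[THEN exE])
    have cube: "t0 \<in> hilbert_cube" "t l \<in> hilbert_cube" for l using t0 t unfolding E_def by simp_all
    define \<mu> where "\<mu> l h = weighted_sum x (t l) h - weighted_sum x t0 h" for l h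
    have "\<exists>a. (\<exists>i\<in>I. a i \<noteq> 0) \<and> (\<forall>h\<in>closure (range e). (\<Sum>i\<in>I. a i * \<mu> i h) = 0)"
    proof (rule functionals_dependent[OF F(1) _ subspace_closure_range_e])
      show "\<forall>\<nu>\<in>F. linear \<nu>" using F(2) bounded_linear.linear by blast
      show "finite I" "card F < card I" using I by simp_all
      show "\<forall>i\<in>I. linear (\<mu> i)"
        unfolding \<mu>_def
        by (intro ballI linear_compose_sub bounded_linear.linear bounded_linear_weighted_sum_cube cube)
      show "\<forall>i\<in>I. \<forall>h\<in>closure (range e). (\<forall>\<nu>\<in>F. \<nu> h = 0) \<longrightarrow> \<mu> i h = 0"
        using F(3) t0(1) t unfolding \<mu>_def by simp
    qed
    then obtain a where a: "\<exists>i\<in>I. a i \<noteq> 0" "\<forall>h\<in>closure (range e). (\<Sum>i\<in>I. a i * \<mu> i h) = 0"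
      by (elim exE conjE)
    define w where "w l j = t l j - t0 j" for l j
    define u where "u j = (\<Sum>l\<in>I. a l * w l j)" for j
    have w_bound: "\<bar>w l j\<bar> \<le> 2" for l j
      using hilbert_cube_bound[OF cube(1), of j] hilbert_cube_bound[OF cube(2), of l j] unfolding w_def by linarith
    have u_bound: "\<bar>u j\<bar> \<le> (\<Sum>l\<in>I. \<bar>a l\<bar> * 2)" for j
      unfolding u_def
      by (rule order_trans[OF sum_abs]) (intro sum_mono, simp add: abs_mult mult_left_mono w_bound)
    have w_sum: "weighted_sum x (w l) h = \<mu> l h" for l h
    proof -
      have "summable (\<lambda>j. t l j * (1/2)^j * apply_bcontfun h (x j))" "summable (\<lambda>j. t0 j * (1/2)^j * apply_bcontfun h (x j))"
        by (rule weighted_sum_summable, rule hilbert_cube_bound, rule cube)+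
      from suminf_diff[OF this] show ?thesis
        unfolding weighted_sum_def \<mu>_def w_def by (simp add: left_diff_distrib)
    qed
    have "weighted_sum x u h = 0" if "h \<in> range e" for h
    proof -
      have "weighted_sum x u h = (\<Sum>l\<in>I. a l * weighted_sum x (w l) h)"
        unfolding u_def using I w_bound by (intro weighted_sum_linear_weights[of I w 2]) simp_all
      also have "\<dots> = 0" using a(2) that closure_subset unfolding w_sum by blast
      finally show ?thesis .
    qed
    then have u_zero: "u j = 0" for j by (rule weights_zero[OF u_bound])
    obtain i where i: "i \<in> I" "a i \<noteq> 0" using a(1) by blast
    have "u i = (\<Sum>l\<in>I. if l = i then a i * (1/4) else 0)"
      unfolding u_def
    proof (intro sum.cong refl)
      fix l assume "l \<in> I"
      have "t l i = (if i = l then 3/4 else 1/2)" "t0 i = 1/2" using t t0(2) i(1) by simp_all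
      then show "a l * w l i = (if l = i then a i * (1/4) else 0)" unfolding w_def by simp
    qed
    also have "\<dots> = a i * (1/4)" using i(1) I by simp
    finally show False using u_zero i(2) by simp
  qed
  then show ?thesis unfolding misses_cube_points_def by (intro exI[of _ "Suc (card F)"] allI impI)
qed

lemma no_countable_homeomorphism: False
proof -
  have q_eq: "range q = range (\<lambda>y k. apply_bcontfun (e k) y)" unfolding q_def ..
  have "colored_refinable (Suc d) (range q)"
    unfolding q_eq
  proof (rule colored_refinable_range[OF compact _ algebra])
    show "continuous_on UNIV (apply_bcontfun (e k))" for k by simp
  qed (rule colored)
  then have Z: "colored_refinable (Suc d ^ m) (Z m)" for m
    using compact_range_q by (rule colored_refinable_tuples)
  show False
  \<comment> \<open>Here p codes the pair of the tolerance index n and the tuple length m.\<close>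
  proof (rule hilbert_cube_not_covered_by_isolated_fibres[of "\<lambda>p. E (fst (prod_decode p)) (snd (prod_decode p))"
        "\<lambda>p. Z (snd (prod_decode p))" "\<lambda>p. Suc d ^ snd (prod_decode p)"])
    show "compact (E (fst (prod_decode p)) (snd (prod_decode p)))" for p by (rule compact_E)
    show "E (fst (prod_decode p)) (snd (prod_decode p)) \<subseteq> UNIV \<times> Z (snd (prod_decode p))" for p
      unfolding E_def by auto
    show "colored_refinable (Suc d ^ snd (prod_decode p)) (Z (snd (prod_decode p)))" for p by (rule Z)
    show "misses_cube_points {t. (t, z) \<in> E (fst (prod_decode p)) (snd (prod_decode p))}"
      if "z \<in> Z (snd (prod_decode p))" for p z
      using that by (rule misses_cube_points_fibre)
    show "\<exists>p z U. open U \<and> z \<in> U \<and> {z' \<in> U. (t, z') \<in> E (fst (prod_decode p)) (snd (prod_decode p))} = {z}"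
      if t: "t \<in> hilbert_cube" for t
    proof -
      obtain n m z U where "open U" "z \<in> U" "{z' \<in> U. (t, z') \<in> E n m} = {z}"
        using works_isolated[OF t] by (elim exE conjE)
      then show ?thesis by (intro exI[of _ "prod_encode (n, m)"] exI[of _ z] exI[of _ U] conjI) simp_all
    qed
  qed
qed

end

section \<open>Construction of the countable set of functions\<close>

lemma apply_Bcontfun_compact:
  fixes f :: "'a::topological_space \<Rightarrow> real"
  assumes "compact (UNIV :: 'a set)" "continuous_on UNIV f"
  shows "apply_bcontfun (Bcontfun f) = f"
  using assms by (intro Bcontfun_inverse) (simp add: bcontfun_def compact_imp_bounded compact_continuous_image)

lemma finite_dimensional_no_homeomorphism:
  assumes inf: "infinite (UNIV :: 'a::t1_space set)"
    and comp: "compact (UNIV :: 'a set)" and normal: "normal_space (euclidean :: 'a topology)"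
    and dim: "covering_dim_le (euclidean :: 'a topology) d"
  shows "\<not> (pointwise_topology :: ('a \<Rightarrow>\<^sub>C real) topology) homeomorphic_space
           (weak_topology :: ('a \<Rightarrow>\<^sub>C real) topology)"
proof
  assume "(pointwise_topology :: ('a \<Rightarrow>\<^sub>C real) topology) homeomorphic_space
      (weak_topology :: ('a \<Rightarrow>\<^sub>C real) topology)"
  then obtain \<Phi> \<Psi> :: "('a \<Rightarrow>\<^sub>C real) \<Rightarrow> ('a \<Rightarrow>\<^sub>C real)"
    where hom: "homeomorphic_maps pointwise_topology weak_topology \<Phi> \<Psi>"
    unfolding homeomorphic_space_def by (elim exE)
  obtain x :: "nat \<Rightarrow> 'a" where x: "inj x"
    using infinite_countable_subset[OF inf] by blast
  have "\<forall>p. \<exists>u. continuous_on UNIV u \<and> (x (fst p) \<noteq> x (snd p) \<longrightarrow> u (x (fst p)) \<noteq> (u (x (snd p)) :: real))"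
  proof
    fix p
    show "\<exists>u. continuous_on UNIV u \<and> (x (fst p) \<noteq> x (snd p) \<longrightarrow> u (x (fst p)) \<noteq> (u (x (snd p)) :: real))"
    proof (cases "x (fst p) = x (snd p)")
      case True
      \<comment> \<open>A default on the diagonal, so that \<open>sep\<close> is defined for all
        pairs of indices.\<close>
      then show ?thesis by (intro exI[of _ "\<lambda>_. 0"]) simp
    next
      case False
      then have V: "open (- {x (snd p)})" "x (fst p) \<in> - {x (snd p)}" by (simp_all add: open_Compl)
      obtain u :: "'a \<Rightarrow> real" where u: "continuous_on UNIV u" "\<And>y. 0 \<le> u y" "0 < u (x (fst p))"
          "\<And>y. 0 < u y \<Longrightarrow> y \<in> - {x (snd p)}"
        by (rule urysohn_function[OF normal V]) (rule that)
      have "\<not> 0 < u (x (snd p))" using u(4) by blast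
      then show ?thesis using u(1,3) by (intro exI[of _ u]) auto
    qed
  qed
  then obtain sep where sep: "\<forall>p. continuous_on UNIV (sep p) \<and>
      (x (fst p) \<noteq> x (snd p) \<longrightarrow> sep p (x (fst p)) \<noteq> (sep p (x (snd p)) :: real))"
    by (rule choice[THEN exE])
  \<comment> \<open>Fixing one refinement for each F ensures that closing off adds only finitely
    many colored functions at a time.\<close>
  define col where "col F = (SOME B. colored_functions d (apply_bcontfun ` F) B)" for F :: "('a \<Rightarrow>\<^sub>C real) set"
  have col: "colored_functions d (apply_bcontfun ` F) (col F)"
    if "finite F" "\<And>y. \<exists>f\<in>apply_bcontfun ` F. 0 < f y" for F
    unfolding col_def
  proof (rule someI_ex[OF colored_functions_exist[OF normal comp dim]])
    show "finite (apply_bcontfun ` F)" using that(1) by simp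
    show "continuous_on UNIV f" if "f \<in> apply_bcontfun ` F" for f using that by auto
    show "\<exists>f\<in>apply_bcontfun ` F. 0 < f y" for y by (rule that(2))
  qed
  \<comment> \<open>The rational constants and separating functions do not depend on F; already the
    empty F puts them into A. Colored functions are added only when F is jointly positive, as
    \<open>col\<close> is arbitrary otherwise.\<close>
  define R where "R F = const_bcontfun ` \<rat> \<union> range (\<lambda>p. Bcontfun (sep p)) \<union> \<Phi> ` F \<union> \<Psi> ` F \<union>
      (\<lambda>(f, g). f + g) ` (F \<times> F) \<union>
      (\<lambda>(f, g). Bcontfun (\<lambda>y. apply_bcontfun f y * apply_bcontfun g y)) ` (F \<times> F) \<union>
      (\<lambda>(f, g). Bcontfun (\<lambda>y. max (apply_bcontfun f y) (apply_bcontfun g y))) ` (F \<times> F) \<union>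
      (if \<forall>y. \<exists>f\<in>apply_bcontfun ` F. 0 < f y then Bcontfun ` (\<Union>c\<le>d. col F c) else {})" for F
  have "countable (R F)" if F: "finite F" for F
  proof -
    have "finite (\<Union>c\<le>d. col F c)" if "\<forall>y. \<exists>f\<in>apply_bcontfun ` F. 0 < f y"
      using col[OF F] that unfolding colored_functions_def by (intro finite_UN_I) simp_all
    then have "countable (if \<forall>y. \<exists>f\<in>apply_bcontfun ` F. 0 < f y then Bcontfun ` (\<Union>c\<le>d. col F c) else {})"
      by (simp add: countable_finite)
    moreover have "countable (range (\<lambda>p. Bcontfun (sep p)))" by (rule countable_image) simp
    moreover have "countable (const_bcontfun ` \<rat> :: ('a \<Rightarrow>\<^sub>C real) set)" by (rule countable_image[OF countable_rat])
    ultimately show ?thesis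
      unfolding R_def using F by (intro countable_Un countable_finite[of "_ ` F"] countable_finite[of "_ ` (F \<times> F)"]) simp_all
  qed
  then obtain A where A: "countable A" "\<And>F. finite F \<Longrightarrow> F \<subseteq> A \<Longrightarrow> R F \<subseteq> A"
    using countable_closed_set[of R] by blast
  have RA: "g \<in> A" if "finite F" "F \<subseteq> A" "g \<in> R F" for F g
    using A(2)[OF that(1,2)] that(3) by blast
  have const: "const_bcontfun r \<in> A" if "r \<in> \<rat>" for r
    by (rule RA[of "{}"]) (use that in \<open>simp_all add: R_def\<close>)
  have sepA: "Bcontfun (sep p) \<in> A" for p
    by (rule RA[of "{}"]) (simp_all add: R_def)
  have \<Phi>A: "\<Phi> f \<in> A" and \<Psi>A: "\<Psi> f \<in> A" if "f \<in> A" for f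
    by (rule RA[of "{f}"]; use that in \<open>simp add: R_def\<close>)+
  have addA: "f + g \<in> A" and multA: "Bcontfun (\<lambda>y. apply_bcontfun f y * apply_bcontfun g y) \<in> A"
    and maxA: "Bcontfun (\<lambda>y. max (apply_bcontfun f y) (apply_bcontfun g y)) \<in> A" if "f \<in> A" "g \<in> A" for f g
    by (rule RA[of "{f, g}"]; use that in \<open>simp add: R_def\<close>)+
  define e where "e = from_nat_into A"
  have "A \<noteq> {}" using const[of 0] by auto
  then have e: "range e = A" unfolding e_def using A(1) by (rule range_from_nat_into)
  have range_eq: "range (\<lambda>k. apply_bcontfun (e k)) = apply_bcontfun ` A"
    unfolding e[symmetric] by (simp add: image_image)
  note apply_Bcontfun = apply_Bcontfun_compact[OF comp]
  have algebra: "rational_lattice_algebra (apply_bcontfun ` A)"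
    unfolding rational_lattice_algebra_def
  proof (intro conjI ballI)
    fix r :: real assume "r \<in> \<rat>"
    then have "apply_bcontfun (const_bcontfun r) \<in> apply_bcontfun ` A" by (intro imageI const)
    moreover have "apply_bcontfun (const_bcontfun r) = (\<lambda>_::'a. r)" by (simp add: const_bcontfun.rep_eq)
    ultimately show "(\<lambda>_. r) \<in> apply_bcontfun ` A" by simp
  next
    fix f g assume "f \<in> apply_bcontfun ` A" "g \<in> apply_bcontfun ` A"
    then obtain f' g' where f: "f = apply_bcontfun f'" "f' \<in> A" and g: "g = apply_bcontfun g'" "g' \<in> A"
      by (elim imageE)
    have "apply_bcontfun (f' + g') \<in> apply_bcontfun ` A" by (intro imageI addA f(2) g(2))
    moreover have "apply_bcontfun (f' + g') = (\<lambda>y. f y + g y)" unfolding f(1) g(1) by (rule ext) simp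
    ultimately show "(\<lambda>y. f y + g y) \<in> apply_bcontfun ` A" by simp
    have cont: "continuous_on UNIV f" "continuous_on UNIV g" unfolding f(1) g(1) by simp_all
    have "apply_bcontfun (Bcontfun (\<lambda>y. f y * g y)) \<in> apply_bcontfun ` A"
      unfolding f(1) g(1) by (intro imageI multA f(2) g(2))
    then show "(\<lambda>y. f y * g y) \<in> apply_bcontfun ` A"
      using apply_Bcontfun[OF continuous_on_mult[OF cont]] by simp
    have "apply_bcontfun (Bcontfun (\<lambda>y. max (f y) (g y))) \<in> apply_bcontfun ` A"
      unfolding f(1) g(1) by (intro imageI maxA f(2) g(2))
    then show "(\<lambda>y. max (f y) (g y)) \<in> apply_bcontfun ` A"
      using apply_Bcontfun[OF continuous_on_max[OF cont]] by simp
  qed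
  have "countable_homeomorphism \<Phi> \<Psi> e x d"
  proof
    show "continuous_map pointwise_topology weak_topology \<Phi>"
      and "continuous_map weak_topology pointwise_topology \<Psi>"
      and "\<Psi> (\<Phi> f) = f" and "\<Phi> (\<Psi> f) = f" for f
      using hom unfolding homeomorphic_maps_def topspace_weak_topology topspace_pointwise_topology by simp_all
    show "compact (UNIV :: 'a set)" by (rule comp)
    show "rational_lattice_algebra (range (\<lambda>k. apply_bcontfun (e k)))" unfolding range_eq by (rule algebra)
    show "\<Phi> f \<in> range e" "\<Psi> f \<in> range e" if "f \<in> range e" for f
      using that \<Phi>A \<Psi>A unfolding e by simp_all
    show "\<exists>k. apply_bcontfun (e k) (x i) \<noteq> apply_bcontfun (e k) (x j)" if "i \<noteq> j" for i j
    proof -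
      have "x i \<noteq> x j" using that x by (simp add: inj_eq)
      then have "sep (i, j) (x i) \<noteq> sep (i, j) (x j)" using sep[THEN spec[of _ "(i, j)"]] by simp
      moreover have "apply_bcontfun (Bcontfun (sep (i, j))) = sep (i, j)"
        by (rule apply_Bcontfun) (use sep in simp)
      moreover have "Bcontfun (sep (i, j)) \<in> range e" unfolding e by (rule sepA)
      then obtain k where "Bcontfun (sep (i, j)) = e k" by (elim rangeE)
      ultimately show ?thesis by (intro exI[of _ k]) simp
    qed
    show "\<exists>B. colored_functions d F B \<and> (\<forall>c\<le>d. B c \<subseteq> range (\<lambda>k. apply_bcontfun (e k)))"
      if F: "finite F" "F \<subseteq> range (\<lambda>k. apply_bcontfun (e k))" "\<And>y. \<exists>f\<in>F. 0 < f y" for F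
    proof -
      obtain F' where F': "F' \<subseteq> A" "finite F'" "F = apply_bcontfun ` F'"
        using finite_subset_image[OF F(1) F(2)[unfolded range_eq]] by blast
      have pos: "\<exists>f\<in>apply_bcontfun ` F'. 0 < f y" for y using F(3) unfolding F'(3) .
      have B: "colored_functions d F (col F')" unfolding F'(3) by (rule col[OF F'(2) pos])
      have "b \<in> apply_bcontfun ` A" if b: "b \<in> col F' c" "c \<le> d" for b c
      proof -
        have "Bcontfun b \<in> R F'" unfolding R_def using pos b by auto
        then have "Bcontfun b \<in> A" by (rule RA[OF F'(2,1)])
        moreover have "continuous_on UNIV b" using B b(1) unfolding colored_functions_def by blast
        then have "apply_bcontfun (Bcontfun b) = b" by (rule apply_Bcontfun)
        ultimately show ?thesis by (metis imageI)
      qed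
      then show ?thesis unfolding range_eq using B by blast
    qed
  qed
  then show False by (rule countable_homeomorphism.no_countable_homeomorphism)
qed

theorem corollary4p5:
  assumes "infinite (UNIV :: 'a::t2_space set)"
    and "finite_dimensional (euclidean :: 'a topology)"
    and "valdivia_compact TYPE('g) (euclidean :: 'a topology)"
  shows "\<not> (pointwise_topology :: ('a \<Rightarrow>\<^sub>C real) topology) homeomorphic_space
           (weak_topology :: ('a \<Rightarrow>\<^sub>C real) topology)"
proof -
  have K: "compact_space (euclidean :: 'a topology)" "Hausdorff_space (euclidean :: 'a topology)"
    using assms(3) unfolding valdivia_compact_def by simp_all
  then have "normal_space (euclidean :: 'a topology)"
    by (simp add: compact_Hausdorff_or_regular_imp_normal_space)
  moreover have "compact (UNIV :: 'a set)"
    using K(1) by (simp add: compact_space_def)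
  moreover obtain d where "covering_dim_le (euclidean :: 'a topology) d"
    using assms(2) unfolding finite_dimensional_def by (elim exE)
  ultimately show ?thesis using finite_dimensional_no_homeomorphism[OF assms(1)] by blast
qed

end
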